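(* Let $T:\Gamma\to\Gamma$ be any automorphism of an arbitrary group $\Gamma$. Let $(A,\alpha)$ be the dual system of $(\Gamma,T)$. Then there exists a conditional expectation $E:A\to B$ of $A$ onto the finite orbit algebra $B$ of $(A,\alpha)$ such that for all $g\in\Gamma$ $$E\lambda(g)=\begin{cases}\lambda(g)&\text{when } g\in F\\ 0&\text{otherwise.}\end{cases}$$ Furthermore, $(A,\alpha)$ is $(E,S)$-mixing, where $S$ is the set of all states on $A$ given by density matrices on $H$.
   Context: $\Gamma$ carries the discrete topology, $H:=L^2(\Gamma)$ with respect to counting measure, and $\lambda$ is the left regular representation, $[\lambda(g)f](h)=f(g^{-1}h)$. $A:=C_r^*(\Gamma)$ is the reduced group C*-algebra, i.e. the C*-subalgebra of $B(H)$ generated by $\{\lambda(g):g\in\Gamma\}$. The automorphism $T$ induces the $*$-automorphism $\alpha$ of $A$ with $\alpha(\lambda(g))=\lambda(Tg)$ for all $g\in\Gamma$; $(A,\alpha)$ (with the action $n\mapsto\alpha^n$) is called the dual system of $(\Gamma,T)$. $F:=\{g\in\Gamma: T^{\mathbb{N}}g\text{ is finite}\}$, where $T^{\mathbb{N}}g:=\{T^ng:n\in\mathbb{N}\}$ and $\mathbb{N}=\{1,2,3,\dots\}$; $F$ is a subgroup of $\Gamma$. The finite orbit algebra $B$ of $(A,\alpha)$ is the C*-subalgebra of $A$ generated by $\{\lambda(g):g\in F\}$. A state $\varphi$ on $A$ is given by a density matrix if $\varphi(a)=\operatorname{Tr}(\rho a)$ for all $a \in A$, where $\rho\ge0$ is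 a trace-class operator on $H$ with $\operatorname{Tr}(\rho)=1$. Given a linear map $E:A\to A$ and a set $S$ of bounded linear functionals on $A$, $(A,\alpha)$ is $(E,S)$-mixing if $\lim_{n\to\infty}\varphi(\alpha^n(a-Ea))=0$ for all $a\in A$ and all $\varphi\in S$. *)

theory Defs
  imports "HOL-Analysis.Analysis"
begin

typedef 'a ell2 = "{f :: 'a \<Rightarrow> complex. (\<lambda>x. (cmod (f x))\<^sup>2) summable_on UNIV}"
  morphisms ell2_apply Abs_ell2
  by (rule exI[of _ "\<lambda>_. 0"]) simp

setup_lifting type_definition_ell2

lemma ell2_add_summable:
  fixes f g :: "'a \<Rightarrow> complex"
  assumes "(\<lambda>x. (cmod (f x))\<^sup>2) summable_on UNIV" "(\<lambda>x. (cmod (g x))\<^sup>2) summable_on UNIV"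
  shows "(\<lambda>x. (cmod (f x + g x))\<^sup>2) summable_on UNIV"
proof (rule summable_on_comparison_test)
  show "(\<lambda>x. 2 * (cmod (f x))\<^sup>2 + 2 * (cmod (g x))\<^sup>2) summable_on UNIV"
    by (intro summable_on_add summable_on_cmult_right assms)
  fix x
  have "(cmod (f x + g x))\<^sup>2 \<le> (cmod (f x) + cmod (g x))\<^sup>2"
    by (intro power_mono norm_triangle_ineq) simp
  also have "\<dots> \<le> 2 * (cmod (f x))\<^sup>2 + 2 * (cmod (g x))\<^sup>2"
    using sum_squares_bound[of "cmod (f x)" "cmod (g x)"] by (simp add: power2_sum)
  finally show "(cmod (f x + g x))\<^sup>2 \<le> 2 * (cmod (f x))\<^sup>2 + 2 * (cmod (g x))\<^sup>2" .
qed simp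

lemma ell2_mult_summable:
  fixes f :: "'a \<Rightarrow> complex"
  assumes "(\<lambda>x. (cmod (f x))\<^sup>2) summable_on UNIV"
  shows "(\<lambda>x. (cmod (c * f x))\<^sup>2) summable_on UNIV"
  using summable_on_cmult_right[OF assms, of "(cmod c)\<^sup>2"]
  by (simp add: norm_mult power_mult_distrib)

lemma ell2_inner_summable:
  fixes f g :: "'a \<Rightarrow> complex"
  assumes "(\<lambda>x. (cmod (f x))\<^sup>2) summable_on UNIV" "(\<lambda>x. (cmod (g x))\<^sup>2) summable_on UNIV"
  shows "(\<lambda>x. f x \<bullet> g x) summable_on UNIV"
proof -
  have "(\<lambda>x. norm (f x \<bullet> g x)) summable_on UNIV"
  proof (rule summable_on_comparison_test)
    show "(\<lambda>x. (cmod (f x))\<^sup>2 + (cmod (g x))\<^sup>2) summable_on UNIV"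
      by (intro summable_on_add assms)
    fix x
    have "norm (f x \<bullet> g x) \<le> cmod (f x) * cmod (g x)"
      using Cauchy_Schwarz_ineq2 by simp
    also have "\<dots> \<le> (cmod (f x))\<^sup>2 + (cmod (g x))\<^sup>2"
      using sum_squares_bound[of "cmod (f x)" "cmod (g x)"]
        mult_nonneg_nonneg[OF norm_ge_zero norm_ge_zero, of "f x" "g x"] by linarith
    finally show "norm (f x \<bullet> g x) \<le> (cmod (f x))\<^sup>2 + (cmod (g x))\<^sup>2" .
  qed simp
  then show ?thesis by (rule abs_summable_summable)
qed

instantiation ell2 :: (type) real_vector
begin

lift_definition zero_ell2 :: "'a ell2" is "\<lambda>_. 0" by simp

lift_definition plus_ell2 :: "'a ell2 \<Rightarrow> 'a ell2 \<Rightarrow> 'a ell2" is "\<lambda>f g x. f x + g x"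
  by (rule ell2_add_summable)

lift_definition uminus_ell2 :: "'a ell2 \<Rightarrow> 'a ell2" is "\<lambda>f x. - f x" by simp

lift_definition minus_ell2 :: "'a ell2 \<Rightarrow> 'a ell2 \<Rightarrow> 'a ell2" is "\<lambda>f g x. f x - g x"
  using ell2_add_summable[of _ "\<lambda>x. - _ x"] by fastforce

lift_definition scaleR_ell2 :: "real \<Rightarrow> 'a ell2 \<Rightarrow> 'a ell2" is "\<lambda>r f x. r *\<^sub>R f x"
  unfolding scaleR_conv_of_real by (rule ell2_mult_summable)

instance
proof
  fix f g h :: "'a ell2" and r s :: real
  show "f + g + h = f + (g + h)" by transfer (simp add: add.assoc)
  show "f + g = g + f" by transfer (simp add: add.commute)
  show "0 + f = f" by transfer simp
  show "- f + f = 0" by transfer simp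
  show "f - g = f + - g" by transfer simp
  show "r *\<^sub>R (f + g) = r *\<^sub>R f + r *\<^sub>R g" by transfer (simp add: scaleR_add_right)
  show "(r + s) *\<^sub>R f = r *\<^sub>R f + s *\<^sub>R f" by transfer (simp add: scaleR_add_left)
  show "r *\<^sub>R s *\<^sub>R f = (r * s) *\<^sub>R f" by transfer simp
  show "1 *\<^sub>R f = f" by transfer simp
qed

end

instantiation ell2 :: (type) real_inner
begin

lift_definition inner_ell2 :: "'a ell2 \<Rightarrow> 'a ell2 \<Rightarrow> real" is "\<lambda>f g. \<Sum>\<^sub>\<infinity>x. f x \<bullet> g x" .

definition norm_ell2 :: "'a ell2 \<Rightarrow> real" where "norm_ell2 f = sqrt (f \<bullet> f)"

definition dist_ell2 :: "'a ell2 \<Rightarrow> 'a ell2 \<Rightarrow> real" where "dist_ell2 f g = norm (f - g)"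

definition sgn_ell2 :: "'a ell2 \<Rightarrow> 'a ell2" where "sgn_ell2 f = f /\<^sub>R norm f"

definition uniformity_ell2 :: "('a ell2 \<times> 'a ell2) filter" where
  "uniformity_ell2 = (INF e\<in>{0<..}. principal {(x, y). dist x y < e})"

definition open_ell2 :: "'a ell2 set \<Rightarrow> bool" where
  "open_ell2 U = (\<forall>x\<in>U. eventually (\<lambda>(x', y). x' = x \<longrightarrow> y \<in> U) uniformity)"

instance
proof
  fix f g h :: "'a ell2" and r :: real
  show "sgn f = f /\<^sub>R norm f" by (rule sgn_ell2_def)
  show "dist f g = norm (f - g)" by (rule dist_ell2_def)
  show "norm f = sqrt (f \<bullet> f)" by (rule norm_ell2_def)
  show "f \<bullet> g = g \<bullet> f" by transfer (simp add: inner_commute)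
  show "(f + g) \<bullet> h = f \<bullet> h + g \<bullet> h"
    by transfer (simp add: inner_add_left infsum_add ell2_inner_summable)
  show "r *\<^sub>R f \<bullet> g = r * (f \<bullet> g)"
    by transfer (simp add: infsum_cmult_right' del: inner_complex_def)
  show "0 \<le> f \<bullet> f" by transfer (simp add: infsum_nonneg)
  show "f \<bullet> f = 0 \<longleftrightarrow> f = 0"
  proof transfer
    fix f :: "'a \<Rightarrow> complex"
    assume "(\<lambda>x. (cmod (f x))\<^sup>2) summable_on UNIV"
    then have "f = (\<lambda>_. 0)" if "(\<Sum>\<^sub>\<infinity>x. f x \<bullet> f x) = 0"
      using nonneg_infsum_le_0D[of "\<lambda>x. (cmod (f x))\<^sup>2" UNIV] that
      by (auto simp: power2_norm_eq_inner)
    then show "(\<Sum>\<^sub>\<infinity>x. f x \<bullet> f x) = 0 \<longleftrightarrow> f = (\<lambda>_. 0)" by auto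
  qed
qed (rule uniformity_ell2_def open_ell2_def)+

end

lift_definition scaleC :: "complex \<Rightarrow> 'a ell2 \<Rightarrow> 'a ell2" (infixr \<open>*\<^sub>C\<close> 75)
  is "\<lambda>c f x. c * f x" by (rule ell2_mult_summable)

text \<open>The complex inner product is linear in the second argument; its real part is the
  \<^class>\<open>real_inner\<close> inner product \<open>(\<bullet>)\<close>, so both induce the same norm.\<close>

lift_definition cinner :: "'a ell2 \<Rightarrow> 'a ell2 \<Rightarrow> complex"
  is "\<lambda>f g. \<Sum>\<^sub>\<infinity>x. cnj (f x) * g x" .

lift_definition ket :: "'a \<Rightarrow> 'a ell2" is "\<lambda>a x. if x = a then 1 else 0"
proof -
  fix a :: 'a
  have "(\<lambda>x. (cmod (if x = a then 1 else 0))\<^sup>2) summable_on {a}" by simp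
  then show "(\<lambda>x. (cmod (if x = a then 1 else 0))\<^sup>2) summable_on UNIV"
    by (rule summable_on_cong_neutral[THEN iffD1, rotated -1]) auto
qed

text \<open>Elements of this type are only real-linear; the bounded operators of the complex Hilbert
  space form the subset \<open>bounded_ops\<close>.\<close>

type_synonym 'a op = "'a ell2 \<Rightarrow>\<^sub>L 'a ell2"

definition bounded_ops :: "'a op set" where
  "bounded_ops = {a. \<forall>c f. blinfun_apply a (c *\<^sub>C f) = c *\<^sub>C blinfun_apply a f}"

lemma bounded_linear_scaleC: "bounded_linear (scaleC c :: 'a ell2 \<Rightarrow> 'a ell2)"
proof (rule bounded_linear_intro)
  fix f g :: "'a ell2" and r :: real
  show "c *\<^sub>C (f + g) = c *\<^sub>C f + c *\<^sub>C g" by transfer (simp add: distrib_left)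
  show "c *\<^sub>C (r *\<^sub>R f) = r *\<^sub>R (c *\<^sub>C f)" by transfer simp
  have "(c *\<^sub>C f) \<bullet> (c *\<^sub>C f) = (cmod c)\<^sup>2 * (f \<bullet> f)"
    by transfer (simp add: norm_mult power_mult_distrib infsum_cmult_right'
        flip: power2_norm_eq_inner)
  then show "norm (c *\<^sub>C f) \<le> norm f * cmod c"
    by (simp add: norm_ell2_def real_sqrt_mult mult.commute)
qed

definition op_scaleC :: "complex \<Rightarrow> 'a op \<Rightarrow> 'a op" (infixr \<open>*\<^sub>O\<close> 75) where
  "c *\<^sub>O a = Blinfun (scaleC c) o\<^sub>L a"

definition op_adj :: "'a op \<Rightarrow> 'a op" where
  "op_adj a = (THE b. \<forall>f g. cinner (blinfun_apply b f) g = cinner f (blinfun_apply a g))"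

definition positive_op :: "'a op \<Rightarrow> bool" where
  "positive_op a \<longleftrightarrow>
     a \<in> bounded_ops \<and> (\<forall>f. cinner f (blinfun_apply a f) \<in> \<real>\<^sub>\<ge>\<^sub>0)"

definition op_abs :: "'a op \<Rightarrow> 'a op" where
  "op_abs a = (THE b. positive_op b \<and> b o\<^sub>L b = op_adj a o\<^sub>L a)"

text \<open>By basis independence, the standard orthonormal basis \<open>ket\<close> serves to define the trace
  class and the trace.\<close>

definition trace_class :: "'a op \<Rightarrow> bool" where
  "trace_class a \<longleftrightarrow> a \<in> bounded_ops \<and>
     (\<lambda>x. cinner (ket x) (blinfun_apply (op_abs a) (ket x))) summable_on UNIV"

definition trace :: "'a op \<Rightarrow> complex" where
  "trace a = (\<Sum>\<^sub>\<infinity>x. cinner (ket x) (blinfun_apply a (ket x)))"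

definition Cstar_subalgebra :: "'a op set \<Rightarrow> bool" where
  "Cstar_subalgebra M \<longleftrightarrow> M \<subseteq> bounded_ops \<and> 0 \<in> M \<and>
     (\<forall>a\<in>M. \<forall>b\<in>M. a + b \<in> M) \<and> (\<forall>c. \<forall>a\<in>M. c *\<^sub>O a \<in> M) \<and>
     (\<forall>a\<in>M. \<forall>b\<in>M. a o\<^sub>L b \<in> M) \<and> (\<forall>a\<in>M. op_adj a \<in> M) \<and> closed M"

definition Cstar_generated :: "'a op set \<Rightarrow> 'a op set" where
  "Cstar_generated X = \<Inter>{M. Cstar_subalgebra M \<and> X \<subseteq> M}"

text \<open>Maps out of a C*-algebra \<open>A\<close> are total functions on operators, of which only the values
  on \<open>A\<close> matter.\<close>

definition star_automorphism :: "'a op set \<Rightarrow> ('a op \<Rightarrow> 'a op) \<Rightarrow> bool" where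
  "star_automorphism A \<alpha> \<longleftrightarrow> bij_betw \<alpha> A A \<and>
     (\<forall>a\<in>A. \<forall>b\<in>A. \<alpha> (a + b) = \<alpha> a + \<alpha> b) \<and>
     (\<forall>c. \<forall>a\<in>A. \<alpha> (c *\<^sub>O a) = c *\<^sub>O \<alpha> a) \<and>
     (\<forall>a\<in>A. \<forall>b\<in>A. \<alpha> (a o\<^sub>L b) = \<alpha> a o\<^sub>L \<alpha> b) \<and>
     (\<forall>a\<in>A. \<alpha> (op_adj a) = op_adj (\<alpha> a))"

text \<open>All the standard defining properties are listed.  Complete positivity is implied:
  by the bimodule property, \<open>\<Sum>\<^sub>i\<^sub>j b\<^sub>i* E(a\<^sub>i* a\<^sub>j) b\<^sub>j = E(x* x)\<close> with
  \<open>x = \<Sum>\<^sub>i a\<^sub>i b\<^sub>i\<close>.\<close>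

definition conditional_expectation ::
    "'a op set \<Rightarrow> 'a op set \<Rightarrow> ('a op \<Rightarrow> 'a op) \<Rightarrow> bool" where
  "conditional_expectation A B E \<longleftrightarrow> B \<subseteq> A \<and> E ` A = B \<and>
     (\<forall>a\<in>A. \<forall>b\<in>A. E (a + b) = E a + E b) \<and>
     (\<forall>c. \<forall>a\<in>A. E (c *\<^sub>O a) = c *\<^sub>O E a) \<and>
     (\<forall>b\<in>B. E b = b) \<and>
     (\<forall>a\<in>A. norm (E a) \<le> norm a) \<and>
     (\<forall>a\<in>A. positive_op a \<longrightarrow> positive_op (E a)) \<and>
     (\<forall>a\<in>A. \<forall>b\<in>B. \<forall>c\<in>B. E (b o\<^sub>L a o\<^sub>L c) = b o\<^sub>L E a o\<^sub>L c)"

text \<open>For \<open>A\<close> containing the identity operator; a positive linear functional then has norm 1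
  iff it maps the identity to 1.\<close>

definition is_state :: "'a op set \<Rightarrow> ('a op \<Rightarrow> complex) \<Rightarrow> bool" where
  "is_state A \<phi> \<longleftrightarrow>
     (\<forall>a\<in>A. \<forall>b\<in>A. \<phi> (a + b) = \<phi> a + \<phi> b) \<and>
     (\<forall>c. \<forall>a\<in>A. \<phi> (c *\<^sub>O a) = c * \<phi> a) \<and>
     (\<forall>a\<in>A. positive_op a \<longrightarrow> \<phi> a \<in> \<real>\<^sub>\<ge>\<^sub>0) \<and>
     \<phi> id_blinfun = 1"

definition density_matrix :: "'a op \<Rightarrow> bool" where
  "density_matrix \<rho> \<longleftrightarrow> positive_op \<rho> \<and> trace_class \<rho> \<and> trace \<rho> = 1"

definition density_states :: "'a op set \<Rightarrow> ('a op \<Rightarrow> complex) set" where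
  "density_states A =
     {\<phi>. is_state A \<phi> \<and> (\<exists>\<rho>. density_matrix \<rho> \<and> (\<forall>a\<in>A. \<phi> a = trace (\<rho> o\<^sub>L a)))}"

definition mixing ::
    "'a op set \<Rightarrow> ('a op \<Rightarrow> 'a op) \<Rightarrow> ('a op \<Rightarrow> 'a op) \<Rightarrow> ('a op \<Rightarrow> complex) set \<Rightarrow> bool" where
  "mixing A \<alpha> E S \<longleftrightarrow>
     (\<forall>a\<in>A. \<forall>\<phi>\<in>S. (\<lambda>n. \<phi> ((\<alpha> ^^ n) (a - E a))) \<longlonglongrightarrow> 0)"

text \<open>The group is a type of class \<^class>\<open>group_add\<close>.  This is the class of arbitrary, not
  necessarily commutative, groups; only the notation is additive, so \<open>g\<inverse>h\<close> reads \<open>- g + h\<close>.\<close>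

lemma bij_left_translation: "bij ((+) (g :: 'g::group_add))"
  by (rule bij_betw_byWitness[of _ "(+) (- g)"]) (auto simp: add.assoc[symmetric])

lift_definition translate :: "'g::group_add \<Rightarrow> 'g ell2 \<Rightarrow> 'g ell2" is "\<lambda>g f h. f (- g + h)"
  by (rule summable_on_reindex_bij_betw[OF bij_left_translation, THEN iffD2])

lift_definition lreg :: "'g::group_add \<Rightarrow> 'g op" is translate
proof (rule bounded_linear_intro)
  fix g :: 'g and f f' :: "'g ell2" and r :: real
  show "translate g (f + f') = translate g f + translate g f'" by transfer simp
  show "translate g (r *\<^sub>R f) = r *\<^sub>R translate g f" by transfer simp
  have "translate g f \<bullet> translate g f = f \<bullet> f"
    by transfer (rule infsum_reindex_bij_betw[OF bij_left_translation])
  then show "norm (translate g f) \<le> norm f * 1" by (simp add: norm_ell2_def)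
qed

definition reduced_Cstar :: "'g::group_add op set" where
  "reduced_Cstar = Cstar_generated (range lreg)"

definition group_automorphism :: "('g::group_add \<Rightarrow> 'g) \<Rightarrow> bool" where
  "group_automorphism T \<longleftrightarrow> bij T \<and> (\<forall>g h. T (g + h) = T g + T h)"

text \<open>For an automorphism \<open>T\<close> such an \<open>\<alpha>\<close> exists, namely \<open>a \<mapsto> U a U*\<close> with
  \<open>U f = f \<circ> inv T\<close>, and its values on \<open>reduced_Cstar\<close> are uniquely determined.\<close>

definition is_dual_action :: "('g::group_add \<Rightarrow> 'g) \<Rightarrow> ('g op \<Rightarrow> 'g op) \<Rightarrow> bool" where
  "is_dual_action T \<alpha> \<longleftrightarrow>
     star_automorphism reduced_Cstar \<alpha> \<and> (\<forall>g. \<alpha> (lreg g) = lreg (T g))"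

definition finite_orbit_elems :: "('g \<Rightarrow> 'g) \<Rightarrow> 'g set" where
  "finite_orbit_elems T = {g. finite {(T ^^ n) g | n. n \<ge> 1}}"

definition finite_orbit_algebra :: "('g::group_add \<Rightarrow> 'g) \<Rightarrow> 'g op set" where
  "finite_orbit_algebra T = Cstar_generated (lreg ` finite_orbit_elems T)"

end

theory Submission
  imports Defs
begin

text \<open>\<open>F\<close> is a subgroup, and \<open>\<lambda>(g)\<close> maps \<open>\<ell>\<^sup>2(Fx)\<close> to itself if \<open>g \<in> F\<close> and to the orthogonal
  complement of \<open>\<ell>\<^sup>2(Fx)\<close> otherwise.  Hence compressing an operator to its block-diagonal part with
  respect to the decomposition of \<open>\<ell>\<^sup>2(\<Gamma>)\<close> along the right cosets of \<open>F\<close> restricts to the required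
  conditional expectation \<open>E\<close>.

  As \<open>\<phi>\<close>, \<open>\<alpha>\<close> and \<open>E\<close> are bounded, it suffices to prove mixing on the generators \<open>\<lambda>(g)\<close>, where only
  \<open>g \<notin> F\<close> matters.  Then the elements \<open>T\<^sup>n g\<close> are pairwise distinct, and
  \<open>Tr(\<rho> \<lambda>(T\<^sup>n g))\<close> tends to \<open>0\<close>, because \<open>\<lambda>(T\<^sup>n g)\<close> eventually moves any given finite set of basis
  vectors off itself and almost all the trace of \<open>\<rho>\<close> is concentrated on such a set.\<close>

section \<open>Square-summable functions\<close>

lemma ell2_eqI: "f = g" if "\<And>x. ell2_apply f x = ell2_apply g x"
  using that by (metis ell2_apply_inject ext)

lemmas ell2_apply_simps [simp] =
  zero_ell2.rep_eq plus_ell2.rep_eq uminus_ell2.rep_eq minus_ell2.rep_eq scaleR_ell2.rep_eq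
  scaleC.rep_eq ket.rep_eq translate.rep_eq

lemma ell2_apply_sum: "ell2_apply (sum f X) x = (\<Sum>i\<in>X. ell2_apply (f i) x)"
  by (induction X rule: infinite_finite_induct) auto

lemma ell2_summable: "(\<lambda>x. (cmod (ell2_apply f x))\<^sup>2) summable_on A"
  using ell2_apply[of f] by (auto intro: summable_on_subset_banach)

lemma norm_ell2_square: "(norm f)\<^sup>2 = (\<Sum>\<^sub>\<infinity>x. (cmod (ell2_apply f x))\<^sup>2)"
  by (simp only: power2_norm_eq_inner inner_ell2.rep_eq)

lemma sum_le_norm_ell2_square: "(\<Sum>x\<in>X. (cmod (ell2_apply f x))\<^sup>2) \<le> (norm f)\<^sup>2" if "finite X"
  unfolding norm_ell2_square by (rule finite_sum_le_infsum) (use that ell2_summable in auto)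

lemma ell2_apply_le_norm: "cmod (ell2_apply f x) \<le> norm f"
  using sum_le_norm_ell2_square[of "{x}" f] by (simp add: power2_le_iff_abs_le)

lemma norm_ell2_le: "norm f \<le> C"
  if "\<And>X. finite X \<Longrightarrow> (\<Sum>x\<in>X. (cmod (ell2_apply f x))\<^sup>2) \<le> C\<^sup>2" "0 \<le> C"
proof -
  have "(norm f)\<^sup>2 \<le> C\<^sup>2"
    unfolding norm_ell2_square by (rule infsum_le_finite_sums) (use that ell2_summable in auto)
  with that(2) show ?thesis by (simp add: power2_le_iff_abs_le)
qed

lemma square_summableI: "(\<lambda>x. (cmod (u x))\<^sup>2) summable_on UNIV"
  if "\<And>X. finite X \<Longrightarrow> (\<Sum>x\<in>X. (cmod (u x))\<^sup>2) \<le> C"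
  by (rule nonneg_bdd_above_summable_on) (use that in \<open>auto intro!: bdd_aboveI2\<close>)

lemma ell2_apply_Abs: "ell2_apply (Abs_ell2 u) x = u x"
  if "(\<lambda>x. (cmod (u x))\<^sup>2) summable_on UNIV"
  using that by (simp add: Abs_ell2_inverse)

section \<open>The complex inner product\<close>

lemma cinner_summable: "(\<lambda>x. cnj (ell2_apply f x) * ell2_apply g x) summable_on UNIV"
proof -
  have "(\<lambda>x. norm (cnj (ell2_apply f x) * ell2_apply g x)) summable_on UNIV"
  proof (rule summable_on_comparison_test)
    show "(\<lambda>x. (cmod (ell2_apply f x))\<^sup>2 + (cmod (ell2_apply g x))\<^sup>2) summable_on UNIV"
      by (intro summable_on_add ell2_summable)
    show "norm (cnj (ell2_apply f x) * ell2_apply g x)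
      \<le> (cmod (ell2_apply f x))\<^sup>2 + (cmod (ell2_apply g x))\<^sup>2" for x
      using sum_squares_bound[of "cmod (ell2_apply f x)" "cmod (ell2_apply g x)"]
        mult_nonneg_nonneg[OF norm_ge_zero norm_ge_zero, of "ell2_apply f x" "ell2_apply g x"]
      unfolding norm_mult complex_mod_cnj by linarith
  qed simp
  then show ?thesis by (rule abs_summable_summable)
qed

lemma cinner_commute: "cinner g f = cnj (cinner f g)"
  by (simp add: cinner.rep_eq mult.commute flip: infsum_cnj)

lemma cinner_add_right: "cinner f (g + h) = cinner f g + cinner f h"
  by (simp add: cinner.rep_eq distrib_left infsum_add cinner_summable)

lemma cinner_scaleC_right: "cinner f (c *\<^sub>C g) = c * cinner f g"
  by (simp add: cinner.rep_eq mult.left_commute[of _ c] infsum_cmult_right')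

lemma cinner_add_left: "cinner (f + g) h = cinner f h + cinner g h"
  by (metis cinner_commute cinner_add_right complex_cnj_add)

lemma cinner_scaleC_left: "cinner (c *\<^sub>C f) g = cnj c * cinner f g"
  by (metis cinner_commute cinner_scaleC_right complex_cnj_mult)

lemma scaleR_conv_scaleC: "r *\<^sub>R f = complex_of_real r *\<^sub>C f" for f :: "'a ell2"
  by (rule ell2_eqI) (simp add: scaleR_conv_of_real)

lemma Re_cinner: "Re (cinner f g) = f \<bullet> g"
  using infsum_Re[OF cinner_summable[of f g]]
  by (simp add: cinner.rep_eq inner_ell2.rep_eq inner_complex_def)

lemma cinner_self: "cinner f f = complex_of_real ((norm f)\<^sup>2)"
proof (rule complex_eqI)
  show "Im (cinner f f) = Im (complex_of_real ((norm f)\<^sup>2))"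
    using arg_cong[OF cinner_commute[of f f], of Im] by simp
qed (simp add: Re_cinner power2_norm_eq_inner)

lemma norm_scaleC: "norm (c *\<^sub>C f) = cmod c * norm f" for f :: "'a ell2"
proof -
  have "(norm (c *\<^sub>C f))\<^sup>2 = (cmod c * norm f)\<^sup>2"
    by (simp add: norm_ell2_square power_mult_distrib norm_mult infsum_cmult_right')
  then show ?thesis by (simp add: power2_eq_iff_nonneg)
qed

text \<open>Multiplying \<open>g\<close> by a unimodular \<open>u\<close> that makes
  \<open>cinner f g\<close> real and nonnegative turns it into the real inner product, to which the
  real Cauchy-Schwarz inequality applies.\<close>

lemma norm_cinner_le: "cmod (cinner f g) \<le> norm f * norm g"
proof (cases "cinner f g = 0")
  case False
  define u where "u = cnj (sgn (cinner f g))"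
  have u: "cmod u = 1" "u * cinner f g = cmod (cinner f g)"
    using False complex_norm_square[of "cinner f g"]
    by (simp_all add: u_def sgn_eq norm_divide power2_eq_square field_simps)
  have "cmod (cinner f g) = f \<bullet> (u *\<^sub>C g)"
    using u(2) by (simp add: cinner_scaleC_right flip: Re_cinner)
  also have "\<dots> \<le> norm f * norm (u *\<^sub>C g)"
    by (rule norm_cauchy_schwarz)
  finally show ?thesis
    by (simp add: norm_scaleC u)
qed simp

interpretation cinner: bounded_bilinear cinner
  by standard (auto simp: cinner_add_left cinner_add_right scaleR_conv_scaleC cinner_scaleC_left
      cinner_scaleC_right scaleR_conv_of_real intro!: exI[of _ 1] norm_cinner_le)

lemma cinner_ket_left [simp]: "cinner (ket x) f = ell2_apply f x"
proof -
  have "cinner (ket x) f = (\<Sum>\<^sub>\<infinity>y\<in>{x}. ell2_apply f y)"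
    unfolding cinner.rep_eq by (rule infsum_cong_neutral) auto
  then show ?thesis by simp
qed

lemma cinner_eqI: "f = g" if "\<And>h. cinner f h = cinner g h"
  by (rule ell2_eqI) (metis that cinner_ket_left cinner_commute)

text \<open>Completeness: the pointwise limit of a Cauchy sequence is its norm limit by Fatou's lemma for
  finite partial sums.\<close>

instance ell2 :: (type) banach
proof
  fix F :: "nat \<Rightarrow> 'a ell2"
  assume F: "Cauchy F"
  have "Cauchy (\<lambda>n. ell2_apply (F n) x)" for x
  proof (rule metric_CauchyI)
    fix e :: real assume "0 < e"
    with F obtain N where N: "norm (F m - F n) < e" if "m \<ge> N" "n \<ge> N" for m n
      unfolding Cauchy_iff by meson
    have "dist (ell2_apply (F m) x) (ell2_apply (F n) x) < e" if "m \<ge> N" "n \<ge> N" for m n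
      using N[OF that] ell2_apply_le_norm[of "F m - F n" x] by (simp add: dist_norm)
    then show "\<exists>N. \<forall>m\<ge>N. \<forall>n\<ge>N. dist (ell2_apply (F m) x) (ell2_apply (F n) x) < e"
      by blast
  qed
  then have "\<forall>x. \<exists>l. (\<lambda>n. ell2_apply (F n) x) \<longlonglongrightarrow> l"
    by (simp add: Cauchy_convergent_iff convergent_def)
  then obtain u where u: "\<And>x. (\<lambda>n. ell2_apply (F n) x) \<longlonglongrightarrow> u x"
    by metis
  have bound: "(\<Sum>x\<in>X. (cmod (u x - ell2_apply (F n) x))\<^sup>2) \<le> e\<^sup>2"
    if "finite X" "\<forall>m\<ge>N. norm (F m - F n) < e" for X n N e
  proof (rule tendsto_upperbound)
    show "(\<lambda>m. \<Sum>x\<in>X. (cmod (ell2_apply (F m) x - ell2_apply (F n) x))\<^sup>2) \<longlonglongrightarrow>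
        (\<Sum>x\<in>X. (cmod (u x - ell2_apply (F n) x))\<^sup>2)"
      by (intro tendsto_intros u)
    show "\<forall>\<^sub>F m in sequentially.
        (\<Sum>x\<in>X. (cmod (ell2_apply (F m) x - ell2_apply (F n) x))\<^sup>2) \<le> e\<^sup>2"
      using eventually_ge_at_top[of N]
    proof eventually_elim
      case (elim m)
      have "(\<Sum>x\<in>X. (cmod (ell2_apply (F m) x - ell2_apply (F n) x))\<^sup>2) \<le> (norm (F m - F n))\<^sup>2"
        using sum_le_norm_ell2_square[OF \<open>finite X\<close>, of "F m - F n"] by simp
      also have "\<dots> \<le> e\<^sup>2"
        using that(2) elim by (intro power_mono) (auto intro: less_imp_le)
      finally show ?case .
    qed
  qed simp
  \<comment> \<open>The bound with \<open>e = 1\<close> makes \<open>u - F N\<close>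
    square-summable; adding \<open>F N\<close> back shows the same for \<open>u\<close>.\<close>
  from F obtain N where "\<forall>m\<ge>N. \<forall>n\<ge>N. norm (F m - F n) < 1"
    unfolding Cauchy_iff by (meson zero_less_one)
  then have "(\<Sum>x\<in>X. (cmod (u x - ell2_apply (F N) x))\<^sup>2) \<le> 1\<^sup>2" if "finite X" for X
    using bound[OF that, of N N 1] by blast
  from ell2_add_summable[OF square_summableI[OF this] ell2_summable[of "F N"]]
  have u_ell2: "ell2_apply (Abs_ell2 u) x = u x" for x
    by (simp add: ell2_apply_Abs)
  have "F \<longlonglongrightarrow> Abs_ell2 u"
  proof (rule metric_LIMSEQ_I)
    fix e :: real assume e: "0 < e"
    with F obtain N where N: "\<forall>m\<ge>N. \<forall>n\<ge>N. norm (F m - F n) < e / 2"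
      unfolding Cauchy_iff by (meson half_gt_zero)
    have "dist (F n) (Abs_ell2 u) < e" if "n \<ge> N" for n
    proof -
      have "norm (Abs_ell2 u - F n) \<le> e / 2"
        using N that bound[of _ N n "e / 2"] e by (intro norm_ell2_le) (auto simp: u_ell2)
      with e show ?thesis by (simp add: dist_norm norm_minus_commute)
    qed
    then show "\<exists>N. \<forall>n\<ge>N. dist (F n) (Abs_ell2 u) < e" by blast
  qed
  then show "convergent F" by (rule convergentI)
qed

section \<open>Coordinate projections\<close>

lift_definition truncate :: "'a set \<Rightarrow> 'a ell2 \<Rightarrow> 'a ell2" is "\<lambda>S f x. if x \<in> S then f x else 0"
  by (rule summable_on_comparison_test) auto

lemmas [simp] = truncate.rep_eq

lemma truncate_add: "truncate S (f + g) = truncate S f + truncate S g"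
  by (rule ell2_eqI) simp

lemma truncate_scaleC: "truncate S (c *\<^sub>C f) = c *\<^sub>C truncate S f"
  by (rule ell2_eqI) simp

lemma norm_truncate_le: "norm (truncate S f) \<le> norm f"
proof (rule norm_ell2_le)
  fix X :: "'a set" assume X: "finite X"
  have "(\<Sum>x\<in>X. (cmod (ell2_apply (truncate S f) x))\<^sup>2) \<le> (\<Sum>x\<in>X. (cmod (ell2_apply f x))\<^sup>2)"
    by (rule sum_mono) simp
  with sum_le_norm_ell2_square[OF X, of f]
  show "(\<Sum>x\<in>X. (cmod (ell2_apply (truncate S f) x))\<^sup>2) \<le> (norm f)\<^sup>2" by linarith
qed simp

lemma bounded_linear_truncate: "bounded_linear (truncate S)"
  by (rule bounded_linear_intro[of _ 1])
    (auto simp: truncate_add scaleR_conv_scaleC truncate_scaleC norm_truncate_le)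

lemma cinner_truncate: "cinner (truncate S f) g = cinner f (truncate S g)"
  unfolding cinner.rep_eq by (rule infsum_cong) simp

lemma norm_truncate_square: "(norm (truncate S f))\<^sup>2 = (\<Sum>\<^sub>\<infinity>x\<in>S. (cmod (ell2_apply f x))\<^sup>2)"
  unfolding norm_ell2_square by (rule infsum_cong_neutral) auto

lemma truncate_finite: "truncate X f = (\<Sum>x\<in>X. ell2_apply f x *\<^sub>C ket x)" if "finite X"
  by (rule ell2_eqI) (use that in \<open>simp add: ell2_apply_sum if_distrib[of "times _"] cong: if_cong\<close>)

text \<open>The squared distance from \<open>truncate X f\<close> to \<open>f\<close> is the tail of
  the convergent series for the squared norm of \<open>f\<close>.\<close>

lemma truncate_tendsto: "((\<lambda>X. truncate X f) \<longlongrightarrow> f) (finite_subsets_at_top UNIV)"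
proof -
  let ?w = "\<lambda>x. (cmod (ell2_apply f x))\<^sup>2"
  have "((\<lambda>X. (norm f)\<^sup>2 - sum ?w X) \<longlongrightarrow> (norm f)\<^sup>2 - (norm f)\<^sup>2) (finite_subsets_at_top UNIV)"
    by (intro tendsto_intros)
      (use has_sum_infsum[OF ell2_summable[of f]] in \<open>simp add: norm_ell2_square has_sum_def\<close>)
  moreover have "\<forall>\<^sub>F X in finite_subsets_at_top UNIV.
      (norm f)\<^sup>2 - sum ?w X = (norm (truncate X f - f))\<^sup>2"
  proof (rule eventually_finite_subsets_at_top_weakI)
    fix X :: "'a set" assume X: "finite X"
    have "truncate X f - f = - truncate (- X) f"
      by (rule ell2_eqI) simp
    then have "(norm (truncate X f - f))\<^sup>2 = (\<Sum>\<^sub>\<infinity>x\<in>- X. ?w x)"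
      by (simp add: norm_truncate_square)
    also have "\<dots> = (norm f)\<^sup>2 - sum ?w X"
      unfolding norm_ell2_square Compl_eq_Diff_UNIV using X
      by (subst infsum_Diff) (auto intro: ell2_summable)
    finally show "(norm f)\<^sup>2 - sum ?w X = (norm (truncate X f - f))\<^sup>2" by simp
  qed
  ultimately have "((\<lambda>X. (norm (truncate X f - f))\<^sup>2) \<longlongrightarrow> 0) (finite_subsets_at_top UNIV)"
    by (simp add: tendsto_cong)
  from tendsto_real_sqrt[OF this] show ?thesis
    by (simp add: tendsto_norm_zero_iff LIM_zero_iff)
qed

lemma ell2_has_sum_ket: "((\<lambda>x. ell2_apply f x *\<^sub>C ket x) has_sum f) UNIV"
  unfolding has_sum_def using truncate_tendsto[of f]
  by (rule Lim_transform_eventually)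
    (auto intro!: eventually_finite_subsets_at_top_weakI truncate_finite)


section \<open>Adjoints and C*-subalgebras\<close>

lemma op_scaleC_apply [simp]: "blinfun_apply (c *\<^sub>O a) f = c *\<^sub>C blinfun_apply a f"
  by (simp add: op_scaleC_def bounded_linear_Blinfun_apply bounded_linear_scaleC)

lemmas [simp] = blinfun.add_left blinfun.diff_left

lemma norm_op_scaleC_le: "norm (c *\<^sub>O a) \<le> cmod c * norm a"
proof (rule norm_blinfun_bound)
  show "norm (blinfun_apply (c *\<^sub>O a) f) \<le> cmod c * norm a * norm f" for f
    using mult_left_mono[OF norm_blinfun[of a f], of "cmod c"]
    by (simp add: norm_scaleC mult.assoc)
qed simp

lemma scaleR_conv_op_scaleC: "r *\<^sub>R a = complex_of_real r *\<^sub>O a" for a :: "'a op"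
  by (rule blinfun_eqI) (simp add: scaleR_conv_scaleC blinfun.scaleR_left)

lemma op_scaleC_add: "c *\<^sub>O (a + b) = c *\<^sub>O a + c *\<^sub>O b"
  by (rule blinfun_eqI) (simp add: linear_add[OF bounded_linear.linear[OF bounded_linear_scaleC]])

lemma op_scaleC_op_scaleC: "c *\<^sub>O d *\<^sub>O a = (c * d) *\<^sub>O a"
  by (rule blinfun_eqI) (auto intro: ell2_eqI)

lemma diff_conv_op_scaleC: "a - b = a + (- 1) *\<^sub>O b" for a :: "'a op"
  using scaleR_conv_op_scaleC[of "- 1" b] by simp

lemma bounded_linear_op_scaleC: "bounded_linear ((*\<^sub>O) c)"
  by (rule bounded_linear_intro[of _ "cmod c"])
    (auto simp: op_scaleC_add scaleR_conv_op_scaleC op_scaleC_op_scaleC mult.commute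
      intro: order.trans[OF norm_op_scaleC_le])

lemma bounded_ops_has_sum:
  "((\<lambda>x. ell2_apply f x *\<^sub>C blinfun_apply a (ket x)) has_sum blinfun_apply a f) UNIV"
  if "a \<in> bounded_ops"
  using has_sum_bounded_linear[OF blinfun.bounded_linear_right ell2_has_sum_ket[of f], of a] that
  by (simp add: bounded_ops_def)

text \<open>The coordinates of an adjoint are forced: at \<open>x\<close>, its value on
  \<open>f\<close> must be \<open>u f x\<close>. They are square-summable because the finitely
  supported vector \<open>h\<close> built from them satisfies
  \<open>cinner (blinfun_apply a h) f = (norm h)\<^sup>2\<close>, whence
  \<open>norm h \<le> norm a * norm f\<close>.\<close>

lemma adjoint_exists:
  assumes a: "a \<in> bounded_ops"
  shows "\<exists>b\<in>bounded_ops. \<forall>f g. cinner (blinfun_apply b f) g = cinner f (blinfun_apply a g)"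
proof -
  define u where "u f x = cinner (blinfun_apply a (ket x)) f" for f x
  have u_le: "(\<Sum>x\<in>X. (cmod (u f x))\<^sup>2) \<le> (norm a * norm f)\<^sup>2" if X: "finite X" for X f
  proof -
    define h where "h = (\<Sum>x\<in>X. u f x *\<^sub>C ket x)"
    define S where "S = (\<Sum>x\<in>X. (cmod (u f x))\<^sup>2)"
    have h_apply: "ell2_apply h x = (if x \<in> X then u f x else 0)" for x
      using X by (simp add: h_def ell2_apply_sum if_distrib[of "times _"] cong: if_cong)
    have norm_h: "(norm h)\<^sup>2 = S"
      unfolding norm_ell2_square S_def infsum_finite[OF X, symmetric]
      by (rule infsum_cong_neutral) (auto simp: h_apply)
    have "cinner (blinfun_apply a h) f = of_real S"
      using a by (simp add: h_def S_def blinfun.sum_right bounded_ops_def cinner.sum_left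
          cinner_scaleC_left complex_norm_square mult.commute u_def del: of_real_power)
    moreover have "S \<ge> 0"
      by (simp add: S_def sum_nonneg)
    ultimately have "S \<le> norm (blinfun_apply a h) * norm f"
      using norm_cinner_le[of "blinfun_apply a h" f] by simp
    also have "\<dots> \<le> norm h * (norm a * norm f)"
      using mult_right_mono[OF norm_blinfun[of a h], of "norm f"] by (simp add: ac_simps)
    finally have "norm h * norm h \<le> norm h * (norm a * norm f)"
      unfolding norm_h[symmetric] power2_eq_square .
    then have "norm h \<le> norm a * norm f"
      by (cases "norm h = 0") (auto simp: mult_le_cancel_left)
    then show ?thesis
      unfolding S_def[symmetric] norm_h[symmetric] by (rule power_mono) simp
  qed
  define b where "b f = Abs_ell2 (u f)" for f
  have b_apply: "ell2_apply (b f) x = u f x" for f x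
    unfolding b_def by (rule ell2_apply_Abs) (rule square_summableI[OF u_le])
  have "bounded_linear b"
  proof (rule bounded_linear_intro)
    show "norm (b f) \<le> norm f * norm a" for f
      by (rule norm_ell2_le) (use u_le in \<open>simp_all add: b_apply mult.commute\<close>)
  qed (auto intro!: ell2_eqI
      simp: b_apply u_def cinner_add_right scaleR_conv_scaleC cinner_scaleC_right)
  note b' = bounded_linear_Blinfun_apply[OF this]
  have "Blinfun b \<in> bounded_ops"
    by (auto simp: bounded_ops_def b' b_apply u_def cinner_scaleC_right intro!: ell2_eqI)
  moreover have "cinner (b f) g = cinner f (blinfun_apply a g)" for f g
  proof -
    \<comment> \<open>Expanding \<open>g\<close> in the basis produces the series that defines
      \<open>cinner (b f) g\<close>.\<close>
    have "((\<lambda>x. ell2_apply g x * cinner f (blinfun_apply a (ket x))) has_sum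
        cinner f (blinfun_apply a g)) UNIV"
      using has_sum_bounded_linear[OF cinner.bounded_linear_right bounded_ops_has_sum[OF a]]
      by (simp add: cinner_scaleC_right)
    then show ?thesis
      by (simp add: cinner.rep_eq[of "b f"] b_apply u_def mult.commute infsumI
          flip: cinner_commute)
  qed
  ultimately show ?thesis by (metis b')
qed

text \<open>Vectors are separated by \<open>cinner\<close>, so a candidate with the adjoint relation
  is the one picked by \<open>THE\<close>. Adjoints are computed below by exhibiting such a
  candidate.\<close>

lemma op_adj_eqI: "op_adj a = b"
  if "\<And>f g. cinner (blinfun_apply b f) g = cinner f (blinfun_apply a g)"
  unfolding op_adj_def by (rule the_equality) (auto intro!: blinfun_eqI cinner_eqI simp: that)

lemma op_adj_bounded_ops [simp]: "op_adj a \<in> bounded_ops" if "a \<in> bounded_ops"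
  using adjoint_exists[OF that] op_adj_eqI by metis

lemma cinner_op_adj_left:
  "cinner (blinfun_apply (op_adj a) f) g = cinner f (blinfun_apply a g)" if "a \<in> bounded_ops"
  using adjoint_exists[OF that] op_adj_eqI by metis

lemma cinner_op_adj_right:
  "cinner f (blinfun_apply (op_adj a) g) = cinner (blinfun_apply a f) g" if "a \<in> bounded_ops"
  by (metis cinner_op_adj_left[OF that] cinner_commute)

lemma norm_op_adj_le: "norm (op_adj a) \<le> norm a" if "a \<in> bounded_ops"
proof (rule norm_blinfun_bound)
  fix f
  let ?g = "blinfun_apply (op_adj a) f"
  \<comment> \<open>Moving the adjoint across leaves one factor \<open>norm ?g\<close> on the right,
    which cancels.\<close>
  have "(norm ?g)\<^sup>2 = cmod (cinner f (blinfun_apply a ?g))"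
    by (simp add: cinner_self norm_power flip: cinner_op_adj_left[OF that])
  also have "\<dots> \<le> norm f * (norm a * norm ?g)"
    by (intro order.trans[OF norm_cinner_le] mult_left_mono norm_blinfun) simp
  finally show "norm ?g \<le> norm a * norm f"
    by (cases "norm ?g = 0")
      (auto simp: power2_eq_square mult_le_cancel_right mult.left_commute mult.commute)
qed simp

lemma bounded_ops_closed_under [simp]:
  "0 \<in> bounded_ops" "id_blinfun \<in> bounded_ops"
  "a \<in> bounded_ops \<Longrightarrow> b \<in> bounded_ops \<Longrightarrow> a + b \<in> bounded_ops"
  "a \<in> bounded_ops \<Longrightarrow> b \<in> bounded_ops \<Longrightarrow> a - b \<in> bounded_ops"
  "a \<in> bounded_ops \<Longrightarrow> c *\<^sub>O a \<in> bounded_ops"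
  "a \<in> bounded_ops \<Longrightarrow> b \<in> bounded_ops \<Longrightarrow> a o\<^sub>L b \<in> bounded_ops"
  by (auto simp: bounded_ops_def intro!: ell2_eqI simp: algebra_simps)

lemma op_adj_add: "op_adj (a + b) = op_adj a + op_adj b"
  if "a \<in> bounded_ops" "b \<in> bounded_ops"
  using that by (intro op_adj_eqI) (simp add: cinner_add_left cinner_add_right cinner_op_adj_left)

lemma op_adj_scaleC: "op_adj (c *\<^sub>O a) = cnj c *\<^sub>O op_adj a" if "a \<in> bounded_ops"
  using that by (intro op_adj_eqI)
    (simp add: cinner_scaleC_left cinner_scaleC_right cinner_op_adj_left)

lemma op_adj_diff: "op_adj (a - b) = op_adj a - op_adj b"
  if "a \<in> bounded_ops" "b \<in> bounded_ops"
  using that by (simp add: diff_conv_op_scaleC op_adj_add op_adj_scaleC)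

lemma op_adj_compose: "op_adj (a o\<^sub>L b) = op_adj b o\<^sub>L op_adj a"
  if "a \<in> bounded_ops" "b \<in> bounded_ops"
  using that by (intro op_adj_eqI) (simp add: cinner_op_adj_left)

lemma op_adj_adj: "op_adj (op_adj a) = a" if "a \<in> bounded_ops"
  using that by (intro op_adj_eqI) (simp add: cinner_op_adj_right)

lemma op_adj_id [simp]: "op_adj id_blinfun = id_blinfun"
  by (rule op_adj_eqI) simp

lemma op_adj_zero [simp]: "op_adj 0 = 0"
  by (rule op_adj_eqI) (simp add: cinner.zero_left cinner.zero_right)

text \<open>The right-hand side replaces the definite description by equations continuous in
  \<open>a\<close>, which exposes self-adjointness as a closed condition.\<close>

lemma self_adjoint_iff: "op_adj a = a \<longleftrightarrow>
    (\<forall>f g. cinner (blinfun_apply a f) g = cinner f (blinfun_apply a g))" if "a \<in> bounded_ops"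
  using op_adj_eqI[of a a] cinner_op_adj_left[OF that] by metis

lemma continuous_on_blinfun_apply [continuous_intros]:
  "continuous_on UNIV (\<lambda>a :: 'a op. blinfun_apply a f)"
  by (rule linear_continuous_on) (rule blinfun.bounded_linear_left)

lemma closed_bounded_ops: "closed (bounded_ops :: 'a op set)"
  unfolding bounded_ops_def
  by (intro closed_Collect_all closed_Collect_eq continuous_intros
      bounded_linear.continuous_on[OF bounded_linear_scaleC])

lemma closed_self_adjoint: "closed {a :: 'a op.
    \<forall>f g. cinner (blinfun_apply a f) g = cinner f (blinfun_apply a g)}"
  by (intro closed_Collect_all closed_Collect_eq continuous_intros cinner.continuous_on)

section \<open>C*-subalgebras and spans of generators\<close>

lemma Cstar_subalgebra_bounded_ops: "Cstar_subalgebra bounded_ops"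
  unfolding Cstar_subalgebra_def by (simp add: closed_bounded_ops)

lemma Cstar_subalgebraD:
  assumes "Cstar_subalgebra M"
  shows "M \<subseteq> bounded_ops" "a \<in> M \<Longrightarrow> a \<in> bounded_ops" "0 \<in> M"
    "a \<in> M \<Longrightarrow> b \<in> M \<Longrightarrow> a + b \<in> M"
    "a \<in> M \<Longrightarrow> c *\<^sub>O a \<in> M"
    "a \<in> M \<Longrightarrow> b \<in> M \<Longrightarrow> a o\<^sub>L b \<in> M"
    "a \<in> M \<Longrightarrow> op_adj a \<in> M" "closed M"
  using assms unfolding Cstar_subalgebra_def by blast+

lemma Cstar_subalgebra_diff: "a - b \<in> M" if "Cstar_subalgebra M" "a \<in> M" "b \<in> M"
  using that by (simp add: diff_conv_op_scaleC Cstar_subalgebraD)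

lemma Cstar_subalgebra_generated: "Cstar_subalgebra (Cstar_generated X)" if "X \<subseteq> bounded_ops"
proof -
  have "Cstar_generated X \<subseteq> bounded_ops"
    using that Cstar_subalgebra_bounded_ops unfolding Cstar_generated_def by blast
  moreover have "closed (Cstar_generated X)"
    unfolding Cstar_generated_def by (rule closed_Inter) (auto dest: Cstar_subalgebraD)
  ultimately show ?thesis
    unfolding Cstar_subalgebra_def by (auto simp: Cstar_generated_def dest: Cstar_subalgebraD)
qed

lemma Cstar_generated_superset: "X \<subseteq> Cstar_generated X"
  unfolding Cstar_generated_def by blast

lemma Cstar_generated_least: "Cstar_generated X \<subseteq> M" if "Cstar_subalgebra M" "X \<subseteq> M"
  using that unfolding Cstar_generated_def by blast

text \<open>The operator type is only a real vector space, so all complex multiples are put into the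
  generating set to make the real \<open>span\<close> the complex one.\<close>

definition op_span :: "'a op set \<Rightarrow> 'a op set" where
  "op_span X = span {c *\<^sub>O a | c a. a \<in> X}"

lemma op_span_induct [consumes 1, case_names zero add scale]:
  assumes "a \<in> op_span X"
    and "P 0" "\<And>a b. P a \<Longrightarrow> P b \<Longrightarrow> P (a + b)" "\<And>c a. a \<in> X \<Longrightarrow> P (c *\<^sub>O a)"
  shows "P a"
  using assms(1) unfolding op_span_def
proof (induction rule: span_induct_alt)
  case (step r b x)
  then show ?case
    using assms(3,4) by (auto simp: scaleR_conv_op_scaleC op_scaleC_op_scaleC)
qed (rule assms)

lemma op_span_intros:
  "0 \<in> op_span X" "a \<in> op_span X \<Longrightarrow> b \<in> op_span X \<Longrightarrow> a + b \<in> op_span X"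
  "a \<in> X \<Longrightarrow> c *\<^sub>O a \<in> op_span X"
  unfolding op_span_def by (auto intro: span_zero span_add span_base)

lemma op_span_scaleC: "c *\<^sub>O a \<in> op_span X" if "a \<in> op_span X"
  using that by (induction rule: op_span_induct)
    (auto intro: op_span_intros simp: op_scaleC_add op_scaleC_op_scaleC
      linear_0[OF bounded_linear.linear[OF bounded_linear_op_scaleC]])

text \<open>The span is closed under products and adjoints because \<open>X\<close> is. All the
  operations are continuous on the bounded operators, so they pass to limits.\<close>

lemma Cstar_subalgebra_closure_op_span:
  assumes X: "X \<subseteq> bounded_ops" and comp: "\<And>a b. a \<in> X \<Longrightarrow> b \<in> X \<Longrightarrow> a o\<^sub>L b \<in> X"
    and adj: "\<And>a. a \<in> X \<Longrightarrow> op_adj a \<in> X"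
  shows "Cstar_subalgebra (closure (op_span X))"
proof -
  let ?S = "op_span X"
  have S_bounded: "a \<in> bounded_ops" if "a \<in> ?S" for a
    using that X by (induction rule: op_span_induct) auto
  have S_bounded': "closure ?S \<subseteq> bounded_ops"
    by (rule closure_minimal) (use S_bounded closed_bounded_ops in auto)
  have S_adj: "op_adj a \<in> ?S" if "a \<in> ?S" for a
  proof -
    from that have "a \<in> bounded_ops \<and> op_adj a \<in> ?S"
    proof (induction rule: op_span_induct)
      case zero
      show ?case by (simp add: op_span_intros)
    next
      case (add a b)
      then show ?case by (simp add: op_adj_add op_span_intros)
    next
      case (scale c a)
      then show ?case using X adj by (auto simp: op_adj_scaleC op_span_intros)
    qed
    then show ?thesis ..
  qed
  have S_comp: "a o\<^sub>L b \<in> ?S" if "a \<in> ?S" "b \<in> ?S" for a b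
    using that(1)
  proof (induction rule: op_span_induct)
    case (scale c a)
    from that(2) have "a o\<^sub>L b \<in> ?S"
    proof (induction rule: op_span_induct)
      case (scale d b)
      \<comment> \<open>Pulling a scalar out of the right factor is where complex linearity of
        \<open>a\<close> enters.\<close>
      have "a o\<^sub>L d *\<^sub>O b = d *\<^sub>O (a o\<^sub>L b)"
        using \<open>a \<in> X\<close> X by (intro blinfun_eqI) (auto simp: bounded_ops_def)
      with scale comp[OF \<open>a \<in> X\<close>] show ?case by (auto intro: op_span_intros)
    qed (auto simp: bounded_bilinear.add_right[OF bounded_bilinear_blinfun_compose]
        bounded_bilinear.zero_right[OF bounded_bilinear_blinfun_compose] intro: op_span_intros)
    moreover have "c *\<^sub>O a o\<^sub>L b = c *\<^sub>O (a o\<^sub>L b)"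
      by (rule blinfun_eqI) simp
    ultimately show ?case by (simp add: op_span_scaleC)
  qed (auto simp: bounded_bilinear.add_left[OF bounded_bilinear_blinfun_compose]
        bounded_bilinear.zero_left[OF bounded_bilinear_blinfun_compose] intro: op_span_intros)
  show ?thesis
    unfolding Cstar_subalgebra_def
  proof (intro conjI ballI allI)
    show "0 \<in> closure ?S" using closure_subset op_span_intros(1) by blast
  next
    fix a b assume "a \<in> closure ?S" "b \<in> closure ?S"
    then obtain a' b' where *: "\<And>n. a' n \<in> ?S" "a' \<longlonglongrightarrow> a" "\<And>n. b' n \<in> ?S" "b' \<longlonglongrightarrow> b"
      unfolding closure_sequential by blast
    show "a + b \<in> closure ?S"
      unfolding closure_sequential
      by (intro exI[of _ "\<lambda>n. a' n + b' n"]) (auto intro: op_span_intros tendsto_add *)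
    show "a o\<^sub>L b \<in> closure ?S"
      unfolding closure_sequential
      by (intro exI[of _ "\<lambda>n. a' n o\<^sub>L b' n"])
        (auto intro: S_comp bounded_bilinear.tendsto[OF bounded_bilinear_blinfun_compose] *)
  next
    fix c a assume "a \<in> closure ?S"
    then show "c *\<^sub>O a \<in> closure ?S"
      using closure_bounded_linear_image_subset[OF bounded_linear_op_scaleC, of c ?S]
        closure_mono[of "(*\<^sub>O) c ` ?S" ?S] by (auto intro: op_span_scaleC)
  next
    fix a assume a: "a \<in> closure ?S"
    then obtain a' where *: "\<And>n. a' n \<in> ?S" "a' \<longlonglongrightarrow> a"
      unfolding closure_sequential by blast
    have "(\<lambda>n. op_adj (a' n)) \<longlonglongrightarrow> op_adj a"
    proof (rule metric_tendsto_imp_tendsto[OF *(2)], rule always_eventually, rule allI)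
      have "a \<in> bounded_ops" using a S_bounded' by blast
      then show "dist (op_adj (a' n)) (op_adj a) \<le> dist (a' n) a" for n
        using norm_op_adj_le[of "a' n - a"] S_bounded[OF *(1)[of n]]
        by (simp add: dist_norm op_adj_diff)
    qed
    then show "op_adj a \<in> closure ?S"
      unfolding closure_sequential
      by (intro exI[of _ "\<lambda>n. op_adj (a' n)"]) (auto intro: S_adj *)
  qed (use S_bounded' in auto)
qed


section \<open>Boundedness of automorphisms and states\<close>

text \<open>The square root of \<open>1 - x\<close> has the form \<open>1 - y\<close>, where \<open>y\<close> is the fixed point of the
  contraction \<open>y \<mapsto> (x + y\<^sup>2) / 2\<close> on a ball of self-adjoint elements.\<close>

lemma square_root_exists:
  assumes M: "Cstar_subalgebra M" and x: "x \<in> M" "op_adj x = x" "norm x < 1"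
  obtains y where "y \<in> M" "op_adj y = y" "(id_blinfun - y) o\<^sub>L (id_blinfun - y) = id_blinfun - x"
proof -
  note M' = Cstar_subalgebraD[OF M]
  \<comment> \<open>The smaller root of \<open>r = (norm x + r * r) / 2\<close>: the map
    \<open>p\<close> preserves the ball of radius \<open>r\<close> and contracts it by the factor
    \<open>r < 1\<close>.\<close>
  define r where "r = 1 - sqrt (1 - norm x)"
  have r: "0 \<le> r" "r < 1"
    using x(3) by (auto simp: r_def)
  have "(1 - r)\<^sup>2 = 1 - norm x"
    using x(3) by (simp add: r_def)
  then have r_eq: "norm x + r * r = 2 * r"
    by (simp add: power2_eq_square algebra_simps)
  define S where "S = {y \<in> M. op_adj y = y \<and> norm y \<le> r}"
  define p where "p y = (1 / 2) *\<^sub>R (x + (y o\<^sub>L y))" for y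
  have p_in: "p y \<in> M" "op_adj (p y) = p y" if "y \<in> M" "op_adj y = y" for y
    using that x M'
    by (simp_all add: p_def scaleR_conv_op_scaleC op_adj_scaleC op_adj_add op_adj_compose)
  have "\<exists>!y\<in>S. p y = y"
  proof (rule Banach_fix[OF _ _ r])
    \<comment> \<open>Written as an intersection of closed sets, \<open>S\<close> is complete in the
      Banach space of operators.\<close>
    have "S = M \<inter> {y. \<forall>f g. cinner (blinfun_apply y f) g = cinner f (blinfun_apply y g)} \<inter> cball 0 r"
      using M'(2) by (auto simp: S_def self_adjoint_iff)
    then show "complete S"
      by (simp add: complete_eq_closed closed_Int M' closed_self_adjoint)
    have "0 \<in> S"
      using r M'(3) by (simp add: S_def)
    then show "S \<noteq> {}" by blast
    show "p ` S \<subseteq> S"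
    proof clarify
      fix y assume y: "y \<in> S"
      have "norm (p y) \<le> (norm x + norm y * norm y) / 2"
        unfolding p_def using norm_triangle_ineq[of x "y o\<^sub>L y"] norm_blinfun_compose[of y y] by simp
      also have "\<dots> \<le> (norm x + r * r) / 2"
        using y r by (intro divide_right_mono add_left_mono mult_mono) (auto simp: S_def)
      finally show "p y \<in> S"
        using y p_in[of y] r_eq by (simp add: S_def)
    qed
    fix y z assume y: "y \<in> S" and z: "z \<in> S"
    \<comment> \<open>The noncommutative difference of squares:
      \<open>y y - z z = y (y - z) + (y - z) z\<close>.\<close>
    have "p y - p z = (1 / 2) *\<^sub>R ((y o\<^sub>L (y - z)) + ((y - z) o\<^sub>L z))"
      by (rule blinfun_eqI) (simp add: p_def blinfun.scaleR_left blinfun.diff_right algebra_simps)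
    then have "norm (p y - p z) \<le> (norm y * norm (y - z) + norm (y - z) * norm z) / 2"
      using norm_triangle_ineq[of "y o\<^sub>L (y - z)" "(y - z) o\<^sub>L z"]
        norm_blinfun_compose[of y "y - z"] norm_blinfun_compose[of "y - z" z] by simp
    also have "\<dots> \<le> (r * norm (y - z) + norm (y - z) * r) / 2"
      using y z r by (intro divide_right_mono add_mono mult_mono) (auto simp: S_def)
    finally show "dist (p y) (p z) \<le> r * dist y z"
      by (simp add: dist_norm mult.commute)
  qed
  then obtain y where y: "y \<in> S" "p y = y" by blast
  show thesis
  proof (rule that)
    have "x + (y o\<^sub>L y) = y + y"
      using arg_cong[OF y(2), of "\<lambda>z. 2 *\<^sub>R z"] by (simp add: p_def scaleR_2)
    then have "blinfun_apply x f + blinfun_apply y (blinfun_apply y f)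
        = blinfun_apply y f + blinfun_apply y f" for f
      by (metis blinfun.add_left blinfun_apply_blinfun_compose)
    then show "(id_blinfun - y) o\<^sub>L (id_blinfun - y) = id_blinfun - x"
      by (intro blinfun_eqI) (simp add: blinfun.diff_right algebra_simps)
  qed (use y in \<open>auto simp: S_def\<close>)
qed

lemma star_automorphismD:
  assumes "star_automorphism A \<alpha>"
  shows "bij_betw \<alpha> A A" "a \<in> A \<Longrightarrow> \<alpha> a \<in> A"
    "a \<in> A \<Longrightarrow> b \<in> A \<Longrightarrow> \<alpha> (a + b) = \<alpha> a + \<alpha> b" "a \<in> A \<Longrightarrow> \<alpha> (c *\<^sub>O a) = c *\<^sub>O \<alpha> a"
    "a \<in> A \<Longrightarrow> b \<in> A \<Longrightarrow> \<alpha> (a o\<^sub>L b) = \<alpha> a o\<^sub>L \<alpha> b" "a \<in> A \<Longrightarrow> \<alpha> (op_adj a) = op_adj (\<alpha> a)"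
  using assms unfolding star_automorphism_def by (auto dest: bij_betw_apply)

text \<open>If \<open>norm b < 1\<close>, then \<open>id_blinfun - (op_adj b o\<^sub>L b)\<close>
  has a self-adjoint square root \<open>s\<close> in \<open>A\<close>. Applying \<alpha> shows that
  \<open>id_blinfun - (op_adj (\<alpha> b) o\<^sub>L \<alpha> b)\<close> is
  \<open>op_adj (\<alpha> s) o\<^sub>L \<alpha> s\<close>, hence positive, so
  \<open>\<alpha> b\<close> is a contraction. Scaling does the rest.\<close>

lemma norm_star_automorphism_le:
  assumes A: "Cstar_subalgebra A" "id_blinfun \<in> A" and \<alpha>: "star_automorphism A \<alpha>" and a: "a \<in> A"
  shows "norm (\<alpha> a) \<le> norm a"
proof -
  note A' = Cstar_subalgebraD[OF A(1)] and \<alpha>' = star_automorphismD[OF \<alpha>]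
  have \<alpha>_diff: "\<alpha> (b - c) = \<alpha> b - \<alpha> c" if "b \<in> A" "c \<in> A" for b c
    using that \<alpha>' A' by (simp add: diff_conv_op_scaleC)
  \<comment> \<open>Surjectivity makes \<alpha> unital: a preimage \<open>u\<close> of the identity
    gives \<open>\<alpha> 1 = \<alpha> 1 \<alpha> u = \<alpha> (1 u) = \<alpha> u =
    1\<close>.\<close>
  obtain u where u: "u \<in> A" "\<alpha> u = id_blinfun"
    using bij_betw_imp_surj_on[OF \<alpha>'(1)] A(2) by (metis imageE)
  have "id_blinfun o\<^sub>L u = u" "\<alpha> id_blinfun o\<^sub>L id_blinfun = \<alpha> id_blinfun"
    by (auto intro: blinfun_eqI)
  then have \<alpha>_id: "\<alpha> id_blinfun = id_blinfun"
    using \<alpha>'(5)[OF A(2) u(1)] u(2) by simp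
  have contractive: "norm (\<alpha> b) \<le> 1" if b: "b \<in> A" "norm b < 1" for b
  proof -
    define x where "x = op_adj b o\<^sub>L b"
    have x: "x \<in> A" "op_adj x = x"
      using b(1) A' by (simp_all add: x_def op_adj_compose op_adj_adj)
    have "norm x \<le> norm b * norm b"
      unfolding x_def using b(1) A'(2)
      by (intro order.trans[OF norm_blinfun_compose] mult_right_mono norm_op_adj_le) auto
    also have "\<dots> < 1"
      using b(2) by (metis abs_norm_cancel abs_square_less_1 power2_eq_square)
    finally have "norm x < 1" .
    from square_root_exists[OF A(1) x this] obtain y where y: "y \<in> A" "op_adj y = y"
      and sq: "(id_blinfun - y) o\<^sub>L (id_blinfun - y) = id_blinfun - x" .
    define s where "s = id_blinfun - y"
    have s: "s \<in> A" "op_adj s = s"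
      using y A A' by (simp_all add: s_def Cstar_subalgebra_diff op_adj_diff)
    have "op_adj (\<alpha> s) o\<^sub>L \<alpha> s = \<alpha> (s o\<^sub>L s)"
      using s \<alpha>' by metis
    also have "\<dots> = id_blinfun - (op_adj (\<alpha> b) o\<^sub>L \<alpha> b)"
      unfolding s_def sq using x b A A' \<alpha>' by (simp add: \<alpha>_diff \<alpha>_id) (simp add: x_def A' \<alpha>')
    finally have eq: "op_adj (\<alpha> s) o\<^sub>L \<alpha> s = id_blinfun - (op_adj (\<alpha> b) o\<^sub>L \<alpha> b)" .
    have in_ops: "\<alpha> s \<in> bounded_ops" "\<alpha> b \<in> bounded_ops"
      using s b A' \<alpha>' by auto
    show ?thesis
    proof (rule norm_blinfun_bound)
      fix f
      have "cinner f (blinfun_apply (op_adj (\<alpha> s)) (blinfun_apply (\<alpha> s) f))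
          = cinner f f - cinner f (blinfun_apply (op_adj (\<alpha> b)) (blinfun_apply (\<alpha> b) f))"
        using arg_cong[OF eq, of "\<lambda>z. cinner f (blinfun_apply z f)"] by (simp add: cinner.diff_right)
      then have "complex_of_real ((norm (blinfun_apply (\<alpha> s) f))\<^sup>2)
          = of_real ((norm f)\<^sup>2) - of_real ((norm (blinfun_apply (\<alpha> b) f))\<^sup>2)"
        unfolding cinner_op_adj_right[OF in_ops(1)] cinner_op_adj_right[OF in_ops(2)] cinner_self .
      then have "(norm (blinfun_apply (\<alpha> s) f))\<^sup>2 = (norm f)\<^sup>2 - (norm (blinfun_apply (\<alpha> b) f))\<^sup>2"
        by (metis of_real_diff of_real_eq_iff)
      then have "(norm (blinfun_apply (\<alpha> b) f))\<^sup>2 \<le> (norm f)\<^sup>2"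
        by (metis diff_ge_0_iff_ge zero_le_power2)
      then show "norm (blinfun_apply (\<alpha> b) f) \<le> 1 * norm f"
        by (simp add: power2_le_iff_abs_le)
    qed simp
  qed
  show ?thesis
  proof (rule field_le_epsilon)
    fix e :: real assume e: "0 < e"
    \<comment> \<open>The extra \<open>e\<close> yields the strict bound that the square root
      requires, also when \<open>norm a = 0\<close>.\<close>
    define c where "c = norm a + e"
    have c: "0 < c" using e by (simp add: c_def add_nonneg_pos)
    have "norm ((1 / c) *\<^sub>R a) < 1"
      using c e by (simp add: c_def)
    then have "norm (\<alpha> ((1 / c) *\<^sub>R a)) \<le> 1"
      using contractive[of "(1 / c) *\<^sub>R a"] a A' by (simp add: scaleR_conv_op_scaleC)
    moreover have "\<alpha> ((1 / c) *\<^sub>R a) = (1 / c) *\<^sub>R \<alpha> a"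
      using a \<alpha>' by (simp add: scaleR_conv_op_scaleC)
    ultimately have "norm (\<alpha> a) \<le> c" using c by (simp add: field_simps)
    then show "norm (\<alpha> a) \<le> norm a + e" by (simp add: c_def)
  qed
qed

lemma is_stateD:
  assumes "is_state A \<phi>"
  shows "a \<in> A \<Longrightarrow> b \<in> A \<Longrightarrow> \<phi> (a + b) = \<phi> a + \<phi> b" "a \<in> A \<Longrightarrow> \<phi> (c *\<^sub>O a) = c * \<phi> a"
    "a \<in> A \<Longrightarrow> positive_op a \<Longrightarrow> \<phi> a \<in> \<real>\<^sub>\<ge>\<^sub>0" "\<phi> id_blinfun = 1"
  using assms unfolding is_state_def by blast+

text \<open>The factor \<open>2\<close>, from splitting into self-adjoint parts, spares the Cauchy-Schwarz inequality
  for states.\<close>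

lemma norm_state_le:
  assumes A: "Cstar_subalgebra A" "id_blinfun \<in> A" and \<phi>: "is_state A \<phi>" and a: "a \<in> A"
  shows "cmod (\<phi> a) \<le> 2 * norm a"
proof -
  note A' = Cstar_subalgebraD[OF A(1)] and \<phi>' = is_stateD[OF \<phi>]
  have self_adjoint: "cmod (\<phi> h) \<le> norm h" if h: "h \<in> A" "op_adj h = h" for h
  proof -
    \<comment> \<open>For either sign \<open>c\<close>, the operator \<open>norm h + c h\<close> is
      positive, since \<open>cinner f (blinfun_apply h f)\<close> is real and bounded by
      \<open>norm h * (norm f)\<^sup>2\<close>.\<close>
    have nonneg: "of_real (norm h) + of_real c * \<phi> h \<in> \<real>\<^sub>\<ge>\<^sub>0" if c: "\<bar>c\<bar> = 1" for c :: real
    proof -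
      let ?k = "of_real (norm h) *\<^sub>O id_blinfun + of_real c *\<^sub>O h"
      have "positive_op ?k"
        unfolding positive_op_def
      proof (intro conjI allI)
        show "?k \<in> bounded_ops" using h A' by simp
        fix f
        have "cnj (cinner f (blinfun_apply h f)) = cinner f (blinfun_apply h f)"
          using h A'(2) cinner_op_adj_left[of h f f] by (simp add: cinner_commute[of f])
        then have "Im (cinner f (blinfun_apply h f)) = 0"
          by (simp add: complex_eq_iff)
        moreover have "\<bar>c * Re (cinner f (blinfun_apply h f))\<bar> \<le> norm h * (norm f)\<^sup>2"
        proof -
          have "\<bar>c * Re (cinner f (blinfun_apply h f))\<bar> \<le> cmod (cinner f (blinfun_apply h f))"
            using c abs_Re_le_cmod by (simp add: abs_mult)
          also have "\<dots> \<le> norm f * (norm h * norm f)"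
            by (intro order.trans[OF norm_cinner_le] mult_left_mono norm_blinfun) simp
          finally show ?thesis by (simp add: power2_eq_square ac_simps)
        qed
        ultimately show "cinner f (blinfun_apply ?k f) \<in> \<real>\<^sub>\<ge>\<^sub>0"
          by (simp add: complex_nonneg_Reals_iff cinner_add_right cinner_scaleC_right cinner_self
              del: of_real_power)
      qed
      then show ?thesis
        using \<phi>'(3)[of ?k] h A A' by (simp add: \<phi>')
    qed
    \<comment> \<open>The two signs together force \<open>\<phi> h\<close> to be real and to lie
      between \<open>- norm h\<close> and \<open>norm h\<close>.\<close>
    from nonneg[of 1] nonneg[of "- 1"] have "Im (\<phi> h) = 0" "\<bar>Re (\<phi> h)\<bar> \<le> norm h"
      by (auto simp: complex_nonneg_Reals_iff)
    then show ?thesis by (simp add: cmod_eq_Re)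
  qed
  \<comment> \<open>The decomposition \<open>a = h + \<i> k\<close> into real and imaginary parts;
    the factor \<open>- \<i> / 2\<close> is \<open>1 / (2 \<i>)\<close>.\<close>
  define h where "h = (1 / 2) *\<^sub>O (a + op_adj a)"
  define k where "k = (- \<i> / 2) *\<^sub>O (a - op_adj a)"
  have a_ops: "a \<in> bounded_ops" and a_adj: "op_adj a \<in> A" using a A' by auto
  have h: "h \<in> A" "op_adj h = h"
    using a_ops a A' by (simp_all add: h_def op_adj_scaleC op_adj_add op_adj_adj add.commute)
  have "op_adj k = (\<i> / 2) *\<^sub>O (op_adj a - a)"
    using a_ops a A' by (simp add: k_def op_adj_scaleC op_adj_diff op_adj_adj)
  also have "\<dots> = k"
    unfolding k_def by (rule blinfun_eqI, rule ell2_eqI) (simp add: algebra_simps)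
  finally have k: "k \<in> A" "op_adj k = k"
    using a a_adj A A' by (auto simp: k_def Cstar_subalgebra_diff)
  have "norm h \<le> norm a"
    using norm_op_scaleC_le[of "1 / 2" "a + op_adj a"] norm_triangle_ineq[of a "op_adj a"]
      norm_op_adj_le[OF a_ops] by (simp add: h_def)
  moreover have "norm k \<le> norm a"
    using norm_op_scaleC_le[of "- \<i> / 2" "a - op_adj a"] norm_triangle_ineq4[of a "op_adj a"]
      norm_op_adj_le[OF a_ops] by (simp add: k_def norm_divide)
  moreover have "a = h + \<i> *\<^sub>O k"
    unfolding h_def k_def
    by (rule blinfun_eqI, rule ell2_eqI) (simp add: algebra_simps flip: mult.assoc)
  then have "\<phi> a = \<phi> h + \<i> * \<phi> k"
    using h k A' \<phi>' by simp
  then have "cmod (\<phi> a) \<le> cmod (\<phi> h) + cmod (\<phi> k)"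
    using norm_triangle_ineq[of "\<phi> h" "\<i> * \<phi> k"] by (simp add: norm_mult)
  ultimately show ?thesis
    using self_adjoint[OF h] self_adjoint[OF k] by simp
qed


section \<open>Block-diagonal parts\<close>

text \<open>Pythagoras: distinct fibres of \<open>q\<close> are disjoint, so the squared norms add
  up to that of the restriction of \<open>f\<close> to the union of the fibres.\<close>

lemma sum_norm_truncate_square_le:
  "(\<Sum>t\<in>K. (norm (truncate (q -` {t}) f))\<^sup>2) \<le> (norm f)\<^sup>2" if "finite K"
proof -
  have "(\<Sum>t\<in>K. (norm (truncate (q -` {t}) f))\<^sup>2) = (norm (truncate (q -` K) f))\<^sup>2"
    using that
  proof (induction rule: finite_induct)
    case (insert t K)
    have "q -` insert t K = q -` {t} \<union> q -` K" by auto
    moreover have "q -` {t} \<inter> q -` K = {}" using insert by auto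
    ultimately show ?case
      using insert by (simp add: norm_truncate_square infsum_Un_disjoint ell2_summable)
  qed (simp add: norm_truncate_square)
  then show ?thesis by (simp add: power_mono norm_truncate_le)
qed

lemma cinner_truncate_finite:
  "cinner (truncate X f) g = (\<Sum>x\<in>X. cnj (ell2_apply f x) * ell2_apply g x)" if "finite X"
  unfolding cinner.rep_eq infsum_finite[OF that, symmetric] by (rule infsum_cong_neutral) auto

text \<open>The block-diagonal part \<open>\<Sum>\<^sub>t P\<^sub>t a P\<^sub>t\<close> of an operator, where \<open>P\<^sub>t\<close> is the projection
  onto the fibre of \<open>q\<close> over \<open>t\<close>.\<close>

definition block_diag :: "('a \<Rightarrow> 'b) \<Rightarrow> 'a op \<Rightarrow> 'a op" where
  "block_diag q a =
     Blinfun (\<lambda>f. Abs_ell2 (\<lambda>x. ell2_apply (blinfun_apply a (truncate (q -` {q x}) f)) x))"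

text \<open>Grouping \<open>X\<close> by fibres bounds each group by
  \<open>(norm a * norm (?P t))\<^sup>2\<close>, and Pythagoras sums these bounds. This makes
  \<open>block_diag\<close> well defined and contractive.\<close>

lemma block_diag_sum_le:
  assumes X: "finite X"
  shows "(\<Sum>x\<in>X. (cmod (ell2_apply (blinfun_apply a (truncate (q -` {q x}) f)) x))\<^sup>2)
    \<le> (norm a * norm f)\<^sup>2"
proof -
  let ?P = "\<lambda>t. truncate (q -` {t}) f"
  have "(\<Sum>x\<in>X. (cmod (ell2_apply (blinfun_apply a (?P (q x))) x))\<^sup>2)
      = (\<Sum>t\<in>q ` X. \<Sum>x\<in>{x \<in> X. q x = t}. (cmod (ell2_apply (blinfun_apply a (?P t)) x))\<^sup>2)"
    by (subst sum.image_gen[OF X, of _ q]) (auto intro!: sum.cong)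
  also have "\<dots> \<le> (\<Sum>t\<in>q ` X. (norm a * norm (?P t))\<^sup>2)"
    by (intro sum_mono order.trans[OF sum_le_norm_ell2_square] power_mono norm_blinfun)
      (use X in auto)
  also have "\<dots> = (norm a)\<^sup>2 * (\<Sum>t\<in>q ` X. (norm (?P t))\<^sup>2)"
    by (simp add: power_mult_distrib sum_distrib_left)
  also have "\<dots> \<le> (norm a)\<^sup>2 * (norm f)\<^sup>2"
    using X by (intro mult_left_mono sum_norm_truncate_square_le) auto
  finally show ?thesis by (simp add: power_mult_distrib)
qed

lemma
  shows block_diag_apply [simp]: "ell2_apply (blinfun_apply (block_diag q a) f) x =
      ell2_apply (blinfun_apply a (truncate (q -` {q x}) f)) x"
    and norm_block_diag_le: "norm (block_diag q a) \<le> norm a"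
proof -
  define b where
    "b f = Abs_ell2 (\<lambda>x. ell2_apply (blinfun_apply a (truncate (q -` {q x}) f)) x)" for f
  have b_apply: "ell2_apply (b f) x = ell2_apply (blinfun_apply a (truncate (q -` {q x}) f)) x"
    for f x
    unfolding b_def by (rule ell2_apply_Abs) (rule square_summableI[OF block_diag_sum_le])
  have norm_b: "norm (b f) \<le> norm a * norm f" for f
    by (rule norm_ell2_le) (use block_diag_sum_le in \<open>simp_all add: b_apply\<close>)
  then have "bounded_linear b"
    by (intro bounded_linear_intro[of _ "norm a"])
      (auto intro!: ell2_eqI simp: b_apply truncate_add blinfun.add_right mult.commute
        blinfun.scaleR_right linear_cmul[OF bounded_linear.linear[OF bounded_linear_truncate]])
  from bounded_linear_Blinfun_apply[OF this]
  have *: "blinfun_apply (block_diag q a) = b"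
    by (simp add: block_diag_def b_def[abs_def])
  show "ell2_apply (blinfun_apply (block_diag q a) f) x =
      ell2_apply (blinfun_apply a (truncate (q -` {q x}) f)) x"
    by (simp add: * b_apply)
  show "norm (block_diag q a) \<le> norm a"
    by (rule norm_blinfun_bound) (use norm_b in \<open>simp_all add: *\<close>)
qed

lemma block_diag_add: "block_diag q (a + b) = block_diag q a + block_diag q b"
  by (rule blinfun_eqI, rule ell2_eqI) simp

lemma block_diag_scaleC: "block_diag q (c *\<^sub>O a) = c *\<^sub>O block_diag q a"
  by (rule blinfun_eqI, rule ell2_eqI) simp

lemma bounded_linear_block_diag: "bounded_linear (block_diag q)"
  by (rule bounded_linear_intro[of _ 1])
    (auto simp: block_diag_add scaleR_conv_op_scaleC block_diag_scaleC norm_block_diag_le)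

lemma block_diag_bounded_ops: "block_diag q a \<in> bounded_ops" if "a \<in> bounded_ops"
  using that unfolding bounded_ops_def by (auto intro!: ell2_eqI simp: truncate_scaleC)

text \<open>On a vector of finite support, the quadratic form is the sum of the forms of
  \<open>a\<close> at the pieces of the vector on the fibres. Truncations converge to
  \<open>f\<close>, and the nonnegative reals are closed.\<close>

lemma positive_block_diag:
  assumes a: "positive_op a"
  shows "positive_op (block_diag q a)"
  unfolding positive_op_def
proof (intro conjI allI)
  show "block_diag q a \<in> bounded_ops"
    using a by (simp add: positive_op_def block_diag_bounded_ops)
  fix f
  have finite: "cinner (truncate X f) (blinfun_apply (block_diag q a) (truncate X f)) \<in> \<real>\<^sub>\<ge>\<^sub>0"
    if X: "finite X" for X
  proof -
    let ?X = "\<lambda>t. {x \<in> X. q x = t}"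
    have X_t: "truncate (q -` {t}) (truncate X f) = truncate (?X t) f" for t
      by (rule ell2_eqI) auto
    have "cinner (truncate X f) (blinfun_apply (block_diag q a) (truncate X f))
        = (\<Sum>t\<in>q ` X. cinner (truncate (?X t) f) (blinfun_apply a (truncate (?X t) f)))"
      by (simp add: cinner_truncate_finite X X_t, subst sum.image_gen[OF X, of _ q])
        (auto intro!: sum.cong)
    also have "\<dots> \<in> \<real>\<^sub>\<ge>\<^sub>0"
      using a by (auto simp: positive_op_def complex_nonneg_Reals_iff intro!: sum_nonneg)
    finally show ?thesis .
  qed
  show "cinner f (blinfun_apply (block_diag q a) f) \<in> \<real>\<^sub>\<ge>\<^sub>0"
  proof (rule Lim_in_closed_set)
    show "((\<lambda>X. cinner (truncate X f) (blinfun_apply (block_diag q a) (truncate X f)))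
        \<longlongrightarrow> cinner f (blinfun_apply (block_diag q a) f)) (finite_subsets_at_top UNIV)"
      by (intro cinner.tendsto blinfun.tendsto tendsto_const truncate_tendsto)
  qed (auto intro: eventually_finite_subsets_at_top_weakI finite)
qed

text \<open>The commutant of the fibre projections. Being a C*-algebra fixed pointwise by
  \<open>block_diag q\<close>, it contains a generated algebra as soon as it contains the
  generators.\<close>

definition block_ops :: "('a \<Rightarrow> 'b) \<Rightarrow> 'a op set" where
  "block_ops q = {b \<in> bounded_ops. \<forall>t f.
     blinfun_apply b (truncate (q -` {t}) f) = truncate (q -` {t}) (blinfun_apply b f)}"

lemma block_ops_commute:
  "blinfun_apply b (truncate (q -` {t}) f) = truncate (q -` {t}) (blinfun_apply b f)"
  if "b \<in> block_ops q"
  using that by (simp add: block_ops_def)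

lemma Cstar_subalgebra_block_ops: "Cstar_subalgebra (block_ops q)"
proof -
  have "closed (block_ops q)"
    unfolding block_ops_def Collect_conj_eq Collect_mem_eq
    by (intro closed_Int closed_bounded_ops closed_Collect_all closed_Collect_eq continuous_intros
        bounded_linear.continuous_on[OF bounded_linear_truncate])
  moreover have "op_adj b \<in> block_ops q" if "b \<in> block_ops q" for b
  proof -
    have b: "b \<in> bounded_ops" using that by (simp add: block_ops_def)
    then show ?thesis
      by (auto simp: block_ops_def cinner_op_adj_left cinner_truncate block_ops_commute[OF that]
          intro!: cinner_eqI)
  qed
  moreover have "0 \<in> block_ops q"
    by (auto simp: block_ops_def intro: ell2_eqI)
  ultimately show ?thesis
    unfolding Cstar_subalgebra_def
    by (auto simp: block_ops_def truncate_add truncate_scaleC)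
qed

lemma block_diag_id: "block_diag q b = b" if "b \<in> block_ops q"
  by (rule blinfun_eqI, rule ell2_eqI) (simp add: block_ops_commute[OF that])

lemma block_diag_bimodule:
  assumes b: "b \<in> block_ops q" and c: "c \<in> block_ops q"
  shows "block_diag q (b o\<^sub>L a o\<^sub>L c) = b o\<^sub>L block_diag q a o\<^sub>L c"
proof (rule blinfun_eqI, rule ell2_eqI)
  fix f x
  let ?P = "truncate (q -` {q x})"
  \<comment> \<open>Compressed to the fibre of \<open>x\<close>, the block-diagonal part of
    \<open>a\<close> is \<open>?P a ?P\<close>. As \<open>b\<close> and \<open>c\<close> commute
    with \<open>?P\<close>, the coordinate at \<open>x\<close> sees only this compression.\<close>
  have P: "?P (blinfun_apply (block_diag q a) g) = ?P (blinfun_apply a (?P g))" for g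
    by (rule ell2_eqI) auto
  have fibre: "ell2_apply g x = ell2_apply (?P g) x" for g by simp
  have "ell2_apply (blinfun_apply (block_diag q (b o\<^sub>L a o\<^sub>L c)) f) x
      = ell2_apply (?P (blinfun_apply b (blinfun_apply a (?P (blinfun_apply c f))))) x"
    by (simp add: block_ops_commute[OF c])
  also have "\<dots> = ell2_apply (?P (blinfun_apply b (blinfun_apply (block_diag q a) (blinfun_apply c f)))) x"
    by (simp only: block_ops_commute[OF b, symmetric] P)
  finally show "ell2_apply (blinfun_apply (block_diag q (b o\<^sub>L a o\<^sub>L c)) f) x
      = ell2_apply (blinfun_apply (b o\<^sub>L block_diag q a o\<^sub>L c) f) x"
    by simp
qed


section \<open>Expectations onto subgroup algebras\<close>

lemma lreg_apply [simp]: "ell2_apply (blinfun_apply (lreg g) f) x = ell2_apply f (- g + x)"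
  by (simp add: lreg.rep_eq)

lemma lreg_bounded_ops [simp]: "lreg g \<in> bounded_ops"
  by (auto simp: bounded_ops_def intro: ell2_eqI)

lemma lreg_compose: "lreg g o\<^sub>L lreg h = lreg (g + h)"
  by (rule blinfun_eqI, rule ell2_eqI) (simp add: minus_add add.assoc del: add_uminus_conv_diff)

lemma lreg_zero: "lreg 0 = id_blinfun"
  by (rule blinfun_eqI, rule ell2_eqI) simp

lemma op_adj_lreg: "op_adj (lreg g) = lreg (- g)"
proof (rule op_adj_eqI)
  show "cinner (blinfun_apply (lreg (- g)) f) h = cinner f (blinfun_apply (lreg g) h)" for f h
    using infsum_reindex_bij_betw[OF bij_left_translation[of g],
        of "\<lambda>x. cnj (ell2_apply f x) * ell2_apply h (- g + x)"]
    by (simp add: cinner.rep_eq add.assoc[symmetric])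
qed

lemma lreg_ket: "blinfun_apply (lreg g) (ket x) = ket (g + x)"
proof (rule ell2_eqI)
  fix y
  have "- g + y = x \<longleftrightarrow> y = g + x"
    by (metis add.assoc add.left_neutral left_minus right_minus)
  then show "ell2_apply (blinfun_apply (lreg g) (ket x)) y = ell2_apply (ket (g + x)) y"
    by simp
qed

lemma Cstar_subalgebra_reduced_Cstar: "Cstar_subalgebra reduced_Cstar"
  unfolding reduced_Cstar_def by (rule Cstar_subalgebra_generated) auto

lemma lreg_reduced_Cstar [simp]: "lreg g \<in> reduced_Cstar"
  using Cstar_generated_superset[of "range lreg"] unfolding reduced_Cstar_def by blast

lemma id_reduced_Cstar [simp]: "id_blinfun \<in> reduced_Cstar"
  using lreg_reduced_Cstar[of 0] by (simp only: lreg_zero)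

text \<open>The operators \<open>lreg g\<close> are closed under product and adjoint, so the closure
  of their span is already a C*-algebra. Approximation then reduces statements about
  \<open>reduced_Cstar\<close> to the generators.\<close>

lemma reduced_Cstar_subset: "reduced_Cstar \<subseteq> closure (op_span (range lreg))"
  unfolding reduced_Cstar_def
proof (rule Cstar_generated_least)
  show "Cstar_subalgebra (closure (op_span (range (lreg :: 'a \<Rightarrow> _))))"
    by (rule Cstar_subalgebra_closure_op_span) (auto simp: lreg_compose op_adj_lreg)
  have "a \<in> op_span X" if "a \<in> X" for a :: "'b op" and X
  proof -
    have "1 *\<^sub>O a = a" by (rule blinfun_eqI, rule ell2_eqI) simp
    with op_span_intros(3)[OF that, of 1] show ?thesis by simp
  qed
  then show "range lreg \<subseteq> closure (op_span (range (lreg :: 'a \<Rightarrow> _)))"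
    using closure_subset by blast
qed

lemma op_span_lreg_subset: "op_span (range lreg) \<subseteq> reduced_Cstar"
proof
  show "a \<in> reduced_Cstar" if "a \<in> op_span (range lreg)" for a
    using that by (induction rule: op_span_induct)
      (auto intro: Cstar_subalgebraD[OF Cstar_subalgebra_reduced_Cstar])
qed

text \<open>As a function of \<open>x\<close>, this is the quotient map whose fibres are the blocks;
  the label of \<open>x\<close> is the coset \<open>F + x\<close> itself.\<close>

definition right_coset :: "'g::group_add set \<Rightarrow> 'g \<Rightarrow> 'g set" where
  "right_coset F x = {y. y - x \<in> F}"

definition coset_expectation :: "'g::group_add set \<Rightarrow> 'g op \<Rightarrow> 'g op" where
  "coset_expectation F = block_diag (right_coset F)"

context
  fixes F :: "'g::group_add set"
  assumes zero: "0 \<in> F" and add: "\<And>g h. g \<in> F \<Longrightarrow> h \<in> F \<Longrightarrow> g + h \<in> F"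
    and uminus: "\<And>g. g \<in> F \<Longrightarrow> - g \<in> F"
begin

lemma right_coset_eq_iff: "right_coset F x = right_coset F y \<longleftrightarrow> x - y \<in> F"
proof
  assume "right_coset F x = right_coset F y"
  moreover have "x \<in> right_coset F x" using zero by (simp add: right_coset_def)
  ultimately show "x - y \<in> F" by (simp add: right_coset_def)
next
  have trans: "z - y \<in> F" if "z - x \<in> F" "x - y \<in> F" for x y z
    using add[OF that] by (simp add: add_diff_eq)
  assume xy: "x - y \<in> F"
  have yx: "y - x \<in> F" using uminus[OF xy] by (simp only: minus_diff_eq)
  show "right_coset F x = right_coset F y"
    unfolding right_coset_def using trans xy yx by blast
qed

text \<open>Right cosets are chosen for this dichotomy: left translation by \<open>- g\<close>
  either preserves each of them or moves every point out of its own. So \<open>lreg g\<close> either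
  is block-diagonal or has zero block-diagonal part.\<close>

lemma right_coset_translate: "right_coset F (- g + x) = right_coset F x \<longleftrightarrow> g \<in> F"
proof -
  have "- g + x - x = - g" by (simp only: diff_conv_add_uminus add.assoc right_minus add_0_right)
  then show ?thesis unfolding right_coset_eq_iff using uminus by (metis minus_minus)
qed

lemma lreg_block_ops: "lreg g \<in> block_ops (right_coset F)" if "g \<in> F"
proof -
  have "right_coset F (- g + x) = right_coset F x" for x
    using that by (simp add: right_coset_translate)
  then show ?thesis by (simp add: block_ops_def ell2_eqI)
qed

lemma coset_expectation_lreg: "coset_expectation F (lreg g) = (if g \<in> F then lreg g else 0)"
proof (cases "g \<in> F")
  case True
  then show ?thesis by (simp add: coset_expectation_def block_diag_id lreg_block_ops)
next
  case False
  then show ?thesis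
    by (auto simp: coset_expectation_def right_coset_translate intro!: blinfun_eqI ell2_eqI)
qed

text \<open>The identity and bimodule properties hold because the subgroup algebra lies in the
  commutant of the block projections. Values on the span lie in that algebra by the formula for
  generators, and continuity extends this to the closure.\<close>

lemma conditional_expectation_coset_expectation:
  "conditional_expectation reduced_Cstar (Cstar_generated (lreg ` F)) (coset_expectation F)"
proof -
  let ?B = "Cstar_generated (lreg ` F)" and ?E = "coset_expectation F"
  have B: "Cstar_subalgebra ?B"
    by (rule Cstar_subalgebra_generated) auto
  have B_A: "?B \<subseteq> reduced_Cstar"
    by (intro Cstar_generated_least Cstar_subalgebra_reduced_Cstar) auto
  have B_block: "?B \<subseteq> block_ops (right_coset F)"
    by (intro Cstar_generated_least Cstar_subalgebra_block_ops) (auto intro: lreg_block_ops)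
  have E_id: "?E b = b" if "b \<in> ?B" for b
    using that B_block by (auto simp: coset_expectation_def intro: block_diag_id)
  have span: "?E a \<in> ?B" if "a \<in> op_span (range lreg)" for a
    using that
  proof (induction rule: op_span_induct)
    case zero
    then show ?case
      using Cstar_subalgebraD(3)[OF B]
      by (simp add: coset_expectation_def linear_0
          bounded_linear.linear[OF bounded_linear_block_diag])
  next
    case (add a b)
    then show ?case
      using Cstar_subalgebraD(4)[OF B] by (simp add: coset_expectation_def block_diag_add)
  next
    case (scale c a)
    then obtain g where "a = lreg g" by blast
    moreover have "?E (lreg g) \<in> ?B"
      using Cstar_generated_superset[of "lreg ` F"] Cstar_subalgebraD(3)[OF B]
      by (auto simp: coset_expectation_lreg)
    ultimately show ?case
      using Cstar_subalgebraD(5)[OF B] by (simp add: coset_expectation_def block_diag_scaleC)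
  qed
  have "?E ` reduced_Cstar \<subseteq> ?E ` closure (op_span (range lreg))"
    by (intro image_mono reduced_Cstar_subset)
  also have "\<dots> \<subseteq> closure (?E ` op_span (range lreg))"
    unfolding coset_expectation_def
    by (rule closure_bounded_linear_image_subset[OF bounded_linear_block_diag])
  also have "\<dots> \<subseteq> ?B"
    by (rule closure_minimal) (use span Cstar_subalgebraD(8)[OF B] in auto)
  finally have "?E ` reduced_Cstar = ?B"
    using E_id B_A by force
  moreover have "?E (b o\<^sub>L a o\<^sub>L c) = b o\<^sub>L ?E a o\<^sub>L c" if "b \<in> ?B" "c \<in> ?B" for a b c
    using that B_block unfolding coset_expectation_def by (intro block_diag_bimodule) auto
  ultimately show ?thesis
    using E_id B_A unfolding conditional_expectation_def
    by (auto simp: coset_expectation_def block_diag_add block_diag_scaleC norm_block_diag_le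
        positive_block_diag)
qed

end


section \<open>Mixing\<close>

text \<open>A weighted Cauchy-Schwarz inequality, whose parameter \<open>t\<close> later puts the
  large factor on a basis vector of small weight. It is positivity of the form at
  \<open>f + z *\<^sub>C g\<close>, with \<open>z\<close> of modulus \<open>1 / t\<close> and the
  phase that turns \<open>z * p\<close> into \<open>- cmod p / t\<close>.\<close>

lemma positive_op_cinner_le:
  assumes \<rho>: "positive_op \<rho>" and t: "0 < t"
  shows "2 * cmod (cinner f (blinfun_apply \<rho> g))
    \<le> t * Re (cinner f (blinfun_apply \<rho> f)) + Re (cinner g (blinfun_apply \<rho> g)) / t"
proof -
  define p where "p = cinner f (blinfun_apply \<rho> g)"
  define p' where "p' = cinner g (blinfun_apply \<rho> f)"
  define D where "D f = cinner f (blinfun_apply \<rho> f)" for f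
  have D: "0 \<le> Re (D f)" "Im (D f) = 0" for f
    using \<rho> unfolding positive_op_def D_def by (simp_all add: complex_nonneg_Reals_iff)
  have D_add: "D (f + z *\<^sub>C g) = D f + z * p + cnj z * p' + cnj z * z * D g" for z
    using \<rho> by (simp add: D_def p_def p'_def positive_op_def bounded_ops_def blinfun.add_right
        cinner_add_left cinner_add_right cinner_scaleC_left cinner_scaleC_right algebra_simps)
  \<comment> \<open>Polarisation: reality of the form at \<open>f + g\<close> compares the imaginary
    parts of \<open>p\<close> and \<open>p'\<close>, and at \<open>f + \<i> *\<^sub>C g\<close> the
    real parts.\<close>
  have "p' = cnj p"
    using D(2)[of "f + 1 *\<^sub>C g"] D(2)[of "f + \<i> *\<^sub>C g"] D(2)[of f] D(2)[of g]
    unfolding D_add by (auto simp: complex_eq_iff)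
  show ?thesis
  proof (cases "p = 0")
    case False
    define z where "z = - of_real (1 / (t * cmod p)) * cnj p"
    have "z * p = - of_real (1 / (t * cmod p)) * (p * cnj p)"
      by (simp add: z_def ac_simps)
    also have "\<dots> = - of_real (cmod p / t)"
      using False t unfolding complex_norm_square[symmetric]
      by (simp add: power2_eq_square)
    finally have z1: "z * p = - of_real (cmod p / t)" .
    then have z2: "cnj z * p' = - of_real (cmod p / t)"
      unfolding \<open>p' = cnj p\<close> by (metis complex_cnj_complex_of_real complex_cnj_minus complex_cnj_mult)
    have "cmod z = 1 / t"
      using False t by (simp add: z_def norm_mult norm_divide)
    then have z3: "cnj z * z = of_real (1 / t ^ 2)"
      using complex_norm_square[of z] by (simp add: power_divide mult.commute)
    have "0 \<le> Re (D (f + z *\<^sub>C g))" by (rule D)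
    also have "\<dots> = Re (D f) - 2 * (cmod p / t) + Re (D g) / t ^ 2"
      unfolding D_add z1 z2 z3 by simp
    finally have "0 \<le> t * (Re (D f) - 2 * (cmod p / t) + Re (D g) / t ^ 2)"
      using t by simp
    also have "\<dots> = t * Re (D f) - 2 * cmod p + Re (D g) / t"
      using t by (simp add: field_simps power2_eq_square)
    finally show ?thesis by (simp add: p_def D_def)
  qed (use D t in \<open>simp add: p_def D_def\<close>)
qed

text \<open>Almost all the mass of the diagonal of \<open>\<rho>\<close> lies on a finite set \<open>Y\<close>.  If \<open>g + Y\<close> is disjoint
  from \<open>Y\<close>, then \<open>x\<close> or \<open>g + x\<close> lies outside \<open>Y\<close> for every \<open>x\<close>, so that every matrix coefficient in
  the trace of \<open>\<rho> \<lambda>(g)\<close> is bounded in terms of the remaining mass.\<close>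

lemma trace_lreg_tendsto_0:
  fixes g :: "nat \<Rightarrow> 'g::group_add"
  assumes \<rho>: "density_matrix \<rho>" and inj: "inj g"
  shows "(\<lambda>n. trace (\<rho> o\<^sub>L lreg (g n))) \<longlonglongrightarrow> 0"
proof (rule LIMSEQ_I)
  fix r :: real assume r: "0 < r"
  \<comment> \<open>The final estimate is \<open>t + s / t \<le> 2 * t = r / 2\<close>.\<close>
  define t where "t = r / 4"
  have t: "0 < t" using r by (simp add: t_def)
  have pos: "positive_op \<rho>" and tr: "trace \<rho> = 1"
    using \<rho> by (auto simp: density_matrix_def)
  define d where "d x = Re (cinner (ket x) (blinfun_apply \<rho> (ket x)))" for x
  have d_nonneg: "0 \<le> d x" for x
    using pos unfolding d_def positive_op_def by (simp add: complex_nonneg_Reals_iff del: cinner_ket_left)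
  \<comment> \<open>A non-summable family has \<open>infsum\<close> equal to the default 0, so trace
    1 forces summability.\<close>
  have "(\<lambda>x. cinner (ket x) (blinfun_apply \<rho> (ket x))) summable_on UNIV"
    using tr infsum_not_exists unfolding trace_def by fastforce
  then have "((\<lambda>x. cinner (ket x) (blinfun_apply \<rho> (ket x))) has_sum 1) UNIV"
    using has_sum_infsum tr unfolding trace_def by fastforce
  from has_sum_Re[OF this] have d: "(d has_sum 1) UNIV"
    by (simp add: d_def[abs_def])
  obtain Y where Y: "finite Y" "dist (sum d Y) 1 \<le> t\<^sup>2"
    using has_sum_finite_approximation[OF d, of "t\<^sup>2"] t by auto
  define e where "e x = (if x \<in> Y then 0 else d x)" for x
  define s where "s = 1 - sum d Y"
  have "(d has_sum s) (UNIV - Y)"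
    unfolding s_def using Y by (intro has_sum_Diff d has_sum_finite) auto
  then have e: "(e has_sum s) UNIV"
    by (rule has_sum_cong_neutral[THEN iffD1, rotated -1]) (auto simp: e_def)
  have s: "s \<le> t\<^sup>2"
    using Y(2) by (simp add: s_def dist_real_def)
  \<comment> \<open>If \<open>x\<close> and \<open>g n + x\<close> both lie in \<open>Y\<close>,
    then \<open>g n\<close> is a difference of elements of \<open>Y\<close>; by injectivity this
    happens for finitely many \<open>n\<close> only.\<close>
  have "finite (g -` ((\<lambda>(y, x). y - x) ` (Y \<times> Y)))"
    using Y inj by (intro finite_vimageI finite_imageI) auto
  then have "\<forall>\<^sub>F n in sequentially. n \<notin> g -` ((\<lambda>(y, x). y - x) ` (Y \<times> Y))"
    unfolding cofinite_eq_sequentially[symmetric] eventually_cofinite by (simp add: vimage_def)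
  then obtain N where N: "\<And>n. n \<ge> N \<Longrightarrow> n \<notin> g -` ((\<lambda>(y, x). y - x) ` (Y \<times> Y))"
    unfolding eventually_sequentially by blast
  have "norm (trace (\<rho> o\<^sub>L lreg (g n)) - 0) < r" if "n \<ge> N" for n
  proof -
    let ?g = "(+) (g n)"
    define m where "m x = cinner (ket x) (blinfun_apply \<rho> (ket (?g x)))" for x
    have outside: "x \<notin> Y \<or> ?g x \<notin> Y" for x
    proof (rule ccontr)
      assume "\<not> (x \<notin> Y \<or> ?g x \<notin> Y)"
      moreover have "g n = ?g x - x" by simp
      ultimately show False using N[OF \<open>n \<ge> N\<close>] by force
    qed
    \<comment> \<open>A common bound for the two cases below: a point outside \<open>Y\<close> among
      \<open>x\<close> and \<open>g n + x\<close> gets the large weight \<open>1 / t\<close>, which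
      is charged to the small remainder \<open>e\<close>. The total mass of \<open>w\<close> is
      \<open>t + s / t\<close>.\<close>
    define w where "w x = t / 2 * d x + t / 2 * d (?g x) + 1 / (2 * t) * e x + 1 / (2 * t) * e (?g x)" for x
    have "((\<lambda>x. d (?g x)) has_sum 1) UNIV" "((\<lambda>x. e (?g x)) has_sum s) UNIV"
      using d e has_sum_reindex_bij_betw[OF bij_left_translation[of "g n"]] by blast+
    then have w: "(w has_sum t / 2 * 1 + t / 2 * 1 + 1 / (2 * t) * s + 1 / (2 * t) * s) UNIV"
      unfolding w_def by (intro has_sum_add has_sum_cmult_right d e)
    have m_w: "cmod (m x) \<le> w x" for x
    proof (cases "x \<in> Y")
      case True
      have "2 * cmod (m x) \<le> t * d x + d (?g x) / t"
        unfolding m_def d_def by (rule positive_op_cinner_le[OF pos t])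
      moreover have "e (?g x) = d (?g x)" "e x = 0" "0 \<le> t * d (?g x)"
        using True outside[of x] d_nonneg[of "?g x"] t by (auto simp: e_def)
      ultimately show ?thesis by (simp add: w_def field_simps)
    next
      case False
      have "2 * cmod (m x) \<le> d x / t + t * d (?g x)"
        using positive_op_cinner_le[OF pos, of "1 / t" "ket x" "ket (?g x)"] t
        unfolding m_def d_def by (simp add: mult.commute)
      moreover have "e x = d x" "0 \<le> t * d x" "0 \<le> e (?g x) / t"
        using False d_nonneg t by (auto simp: e_def)
      ultimately show ?thesis by (simp add: w_def field_simps)
    qed
    have "(\<lambda>x. cmod (m x)) summable_on UNIV"
      by (rule summable_on_comparison_test[OF has_sum_imp_summable[OF w]]) (auto intro: m_w)
    from has_sum_infsum[OF abs_summable_summable[OF this]]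
    have "(m has_sum trace (\<rho> o\<^sub>L lreg (g n))) UNIV"
      by (simp add: trace_def m_def[abs_def] lreg_ket)
    from norm_infsum_le[OF this w m_w]
    have "cmod (trace (\<rho> o\<^sub>L lreg (g n))) \<le> t + s / t"
      by (simp add: add_divide_distrib[symmetric])
    also have "s / t \<le> t"
      using s t by (simp add: field_simps power2_eq_square)
    finally show ?thesis using t by (simp add: t_def)
  qed
  then show "\<exists>N. \<forall>n\<ge>N. norm (trace (\<rho> o\<^sub>L lreg (g n)) - 0) < r" by blast
qed

lemma star_automorphism_funpow: "star_automorphism A (\<alpha> ^^ n)" if "star_automorphism A \<alpha>"
proof (induction n)
  case 0
  then show ?case by (simp add: star_automorphism_def bij_betw_def)
next
  case (Suc n)
  note 1 = star_automorphismD[OF that] and 2 = star_automorphismD[OF Suc]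
  show ?case
    unfolding star_automorphism_def using bij_betw_trans[OF 2(1) 1(1)] by (simp add: 1 2)
qed

section \<open>The subgroup of finite orbits\<close>

context
  fixes T :: "'g::group_add \<Rightarrow> 'g"
  assumes T: "group_automorphism T"
begin

lemma automorphism_funpow_add: "(T ^^ n) (g + h) = (T ^^ n) g + (T ^^ n) h"
  using T by (induction n) (auto simp: group_automorphism_def)

lemma automorphism_funpow_zero: "(T ^^ n) 0 = 0"
  using automorphism_funpow_add[of n 0 0] by (metis add.right_neutral add_left_cancel)

lemma automorphism_funpow_uminus: "(T ^^ n) (- g) = - (T ^^ n) g"
  using automorphism_funpow_add[of n "- g" g]
  by (simp add: automorphism_funpow_zero eq_neg_iff_add_eq_0)

lemma
  shows zero_finite_orbit: "0 \<in> finite_orbit_elems T"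
    and add_finite_orbit: "g \<in> finite_orbit_elems T \<Longrightarrow> h \<in> finite_orbit_elems T \<Longrightarrow>
      g + h \<in> finite_orbit_elems T"
    and uminus_finite_orbit: "g \<in> finite_orbit_elems T \<Longrightarrow> - g \<in> finite_orbit_elems T"
proof -
  let ?O = "\<lambda>g. {(T ^^ n) g |n. n \<ge> 1}"
  have "?O 0 \<subseteq> {0}" by (auto simp: automorphism_funpow_zero)
  then show "0 \<in> finite_orbit_elems T"
    unfolding finite_orbit_elems_def by (auto intro: finite_subset)
  have "?O (g + h) \<subseteq> (\<lambda>(x, y). x + y) ` (?O g \<times> ?O h)"
    by (force simp: automorphism_funpow_add)
  then show "g \<in> finite_orbit_elems T \<Longrightarrow> h \<in> finite_orbit_elems T \<Longrightarrow> g + h \<in> finite_orbit_elems T"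
    unfolding finite_orbit_elems_def mem_Collect_eq
    by (rule finite_subset) (intro finite_imageI finite_cartesian_product)
  have "?O (- g) \<subseteq> uminus ` ?O g"
    by (auto simp: automorphism_funpow_uminus)
  then show "g \<in> finite_orbit_elems T \<Longrightarrow> - g \<in> finite_orbit_elems T"
    unfolding finite_orbit_elems_def mem_Collect_eq by (rule finite_subset) (rule finite_imageI)
qed

text \<open>If two terms coincide, cancelling the injective \<open>T ^^ m\<close> leaves a period
  \<open>p\<close> of \<open>g\<close>, and the orbit is covered by the first \<open>p\<close>
  iterates.\<close>

lemma inj_orbit: "inj (\<lambda>n. (T ^^ n) g)" if "g \<notin> finite_orbit_elems T"
proof (rule ccontr)
  assume "\<not> inj (\<lambda>n. (T ^^ n) g)"
  then obtain m n where mn: "m < n" "(T ^^ m) g = (T ^^ n) g"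
    unfolding inj_def by (metis linorder_neqE_nat)
  define p where "p = n - m"
  have "inj T" using T by (simp add: group_automorphism_def bij_is_inj)
  moreover have "(T ^^ m) ((T ^^ p) g) = (T ^^ m) g"
    using mn by (simp add: p_def flip: comp_apply[of "T ^^ m"] funpow_add)
  ultimately have "(T ^^ p) g = g"
    using inj_fn[of T m] by (simp add: inj_eq)
  then have "(T ^^ k) g \<in> (\<lambda>k. (T ^^ k) g) ` {..<p}" for k
    using funpow_mod_eq[where f = T and n = p and m = k and x = g] mn
    by (intro image_eqI[where x = "k mod p"]) (auto simp: p_def)
  then have "{(T ^^ k) g |k. k \<ge> 1} \<subseteq> (\<lambda>k. (T ^^ k) g) ` {..<p}" by blast
  with that show False
    unfolding finite_orbit_elems_def by (auto dest: finite_subset)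
qed

end

lemma mixing_coset_expectation:
  fixes T :: "'g::group_add \<Rightarrow> 'g" and \<alpha> :: "'g op \<Rightarrow> 'g op"
  assumes T: "group_automorphism T" and \<alpha>: "is_dual_action T \<alpha>"
  defines "E \<equiv> coset_expectation (finite_orbit_elems T)"
  shows "mixing reduced_Cstar \<alpha> E (density_states reduced_Cstar)"
  unfolding mixing_def
proof (intro ballI)
  let ?A = "reduced_Cstar :: 'g op set"
  fix a \<phi> assume a: "a \<in> ?A" and "\<phi> \<in> density_states ?A"
  \<comment> \<open>Both descriptions of \<phi> are used: the state axioms bound it on all of
    \<open>?A\<close>, and the density matrix gives decay on the generators.\<close>
  then obtain \<rho> where state: "is_state ?A \<phi>" and \<rho>: "density_matrix \<rho>"
    and \<phi>_eq: "\<And>a. a \<in> ?A \<Longrightarrow> \<phi> a = trace (\<rho> o\<^sub>L a)"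
    unfolding density_states_def by blast
  note subgroup = zero_finite_orbit[OF T] add_finite_orbit[OF T] uminus_finite_orbit[OF T]
  note E_lreg = coset_expectation_lreg[OF subgroup, folded E_def]
  note A = Cstar_subalgebra_reduced_Cstar
  note A' = Cstar_subalgebraD[OF A] and \<phi>' = is_stateD[OF state]
  have E: "E a \<in> ?A" "E (a + b) = E a + E b" "E (c *\<^sub>O a) = c *\<^sub>O E a" "norm (E a) \<le> norm a"
    if "a \<in> ?A" "b \<in> ?A" for a b c
    using that conditional_expectation_coset_expectation[OF subgroup]
    unfolding conditional_expectation_def E_def by auto
  have \<alpha>_n: "star_automorphism ?A (\<alpha> ^^ n)" for n
    using \<alpha> by (simp add: is_dual_action_def star_automorphism_funpow)
  note \<alpha>' = star_automorphismD[OF \<alpha>_n]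
  have \<alpha>_lreg: "(\<alpha> ^^ n) (lreg g) = lreg ((T ^^ n) g)" for n g
    using \<alpha> by (induction n) (auto simp: is_dual_action_def)
  define L where "L n a = \<phi> ((\<alpha> ^^ n) (a - E a))" for n a
  have in_A: "a - E a \<in> ?A" if "a \<in> ?A" for a
    using that E by (intro Cstar_subalgebra_diff[OF A]) auto
  have L_add: "L n (a + b) = L n a + L n b" if "a \<in> ?A" "b \<in> ?A" for n a b
  proof -
    have "a + b - E (a + b) = (a - E a) + (b - E b)" using that E by simp
    then show ?thesis unfolding L_def using in_A that by (simp only: \<alpha>' \<phi>')
  qed
  have L_scale: "L n (c *\<^sub>O a) = c * L n a" if "a \<in> ?A" for n c a
  proof -
    have "c *\<^sub>O a - E (c *\<^sub>O a) = c *\<^sub>O (a - E a)"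
      using that E by (simp add: linear_diff[OF bounded_linear.linear[OF bounded_linear_op_scaleC]])
    then show ?thesis unfolding L_def using in_A that by (simp only: \<alpha>' \<phi>')
  qed
  \<comment> \<open>One factor 2 comes from the bound for states, the other from
    \<open>a - E a\<close>. Uniformity in \<open>n\<close> is what permits the approximation at the
    end.\<close>
  have L_le: "cmod (L n a) \<le> 4 * norm a" if a: "a \<in> ?A" for n a
  proof -
    have "cmod (L n a) \<le> 2 * norm ((\<alpha> ^^ n) (a - E a))"
      unfolding L_def using in_A[OF a] by (intro norm_state_le[OF A _ state] \<alpha>') auto
    also have "\<dots> \<le> 2 * norm (a - E a)"
      using norm_star_automorphism_le[OF A id_reduced_Cstar \<alpha>_n in_A[OF a]] by simp
    also have "\<dots> \<le> 4 * norm a"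
      using norm_triangle_ineq4[of a "E a"] E(4)[OF a a] by simp
    finally show ?thesis .
  qed
  have span: "(\<lambda>n. L n a) \<longlonglongrightarrow> 0" if "a \<in> op_span (range lreg)" for a
  proof -
    from that have "a \<in> ?A \<and> (\<lambda>n. L n a) \<longlonglongrightarrow> 0"
    proof (induction rule: op_span_induct)
      case zero
      show ?case using L_le[OF A'(3)] A'(3) by simp
    next
      case (add a b)
      then show ?case using tendsto_add[of "\<lambda>n. L n a" 0 _ "\<lambda>n. L n b" 0] by (simp add: L_add A')
    next
      case (scale c a)
      then obtain g where a: "a = lreg g" by blast
      have "(\<lambda>n. L n (lreg g)) \<longlonglongrightarrow> 0"
      proof (cases "g \<in> finite_orbit_elems T")
        case True
        \<comment> \<open>The bound gives \<open>L n 0 = 0\<close>, and \<open>E 0 = 0\<close>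
          because \<open>E\<close> is contractive.\<close>
        have "\<phi> ((\<alpha> ^^ n) 0) = 0" for n
          using L_le[OF A'(3), of n] E(4)[OF A'(3) A'(3)] by (simp add: L_def)
        then show ?thesis using True by (simp add: L_def E_lreg)
      next
        case False
        then have "L n (lreg g) = trace (\<rho> o\<^sub>L lreg ((T ^^ n) g))" for n
          by (simp add: L_def E_lreg \<alpha>_lreg \<phi>_eq)
        with trace_lreg_tendsto_0[OF \<rho> inj_orbit[OF T False]] show ?thesis by simp
      qed
      then show ?case
        unfolding a using tendsto_mult_right_zero[of "\<lambda>n. L n (lreg g)" _ c]
        by (simp add: L_scale A')
    qed
    then show ?thesis ..
  qed
  have "(\<lambda>n. L n a) \<longlonglongrightarrow> 0"
  proof (rule LIMSEQ_I)
    fix r :: real assume r: "0 < r"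
    \<comment> \<open>The approximation costs \<open>4 * (r / 8) = r / 2\<close>; the other half is
      left for \<open>L n b\<close>.\<close>
    obtain b where b: "b \<in> op_span (range lreg)" "dist b a < r / 8"
      using a reduced_Cstar_subset r unfolding closure_approachable
      by (metis (no_types, lifting) closure_approachable subset_eq zero_less_divide_iff zero_less_numeral)
    then have b_A: "b \<in> ?A" using op_span_lreg_subset by blast
    obtain N where N: "\<And>n. n \<ge> N \<Longrightarrow> cmod (L n b) < r / 2"
      using LIMSEQ_D[OF span[OF b(1)], of "r / 2"] r by auto
    have "cmod (L n a - 0) < r" if "n \<ge> N" for n
    proof -
      have ab: "a - b \<in> ?A" using A a b_A by (rule Cstar_subalgebra_diff)
      have "L n a = L n (a - b) + L n b"
        using L_add[OF ab b_A] by simp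
      then have "cmod (L n a) \<le> cmod (L n (a - b)) + cmod (L n b)"
        by (simp add: norm_triangle_ineq)
      with L_le[OF ab, of n] N[OF that] b(2) show ?thesis
        by (simp add: dist_norm norm_minus_commute)
    qed
    then show "\<exists>N. \<forall>n\<ge>N. cmod (L n a - 0) < r" by blast
  qed
  then show "(\<lambda>n. \<phi> ((\<alpha> ^^ n) (a - E a))) \<longlonglongrightarrow> 0"
    by (simp add: L_def)
qed

theorem theorem3p2:
  fixes T :: "'g::group_add \<Rightarrow> 'g" and \<alpha> :: "'g op \<Rightarrow> 'g op"
  assumes "group_automorphism T"
    and "is_dual_action T \<alpha>"
  shows "\<exists>E. conditional_expectation reduced_Cstar (finite_orbit_algebra T) E \<and>
    (\<forall>g. E (lreg g) = (if g \<in> finite_orbit_elems T then lreg g else 0)) \<and>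
    mixing reduced_Cstar \<alpha> E (density_states reduced_Cstar)"
proof -
  note subgroup = zero_finite_orbit[OF assms(1)] add_finite_orbit[OF assms(1)]
    uminus_finite_orbit[OF assms(1)]
  show ?thesis
    unfolding finite_orbit_algebra_def
    using conditional_expectation_coset_expectation[OF subgroup] coset_expectation_lreg[OF subgroup]
      mixing_coset_expectation[OF assms]
    by blast
qed

end
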